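(* Let $m,n\in\mathbb N$ with $m\equiv n\pmod 2$, let $\sigma\in\mathcal B_{nm}$, and write $r=\operatorname{rank}(\sigma)$. If $r=n<m$, then $$\operatorname{rank}(\mathcal B_{mn}^\sigma)=\binom mn(m-n-1)!!.$$
   Context: $\mathbb N=\{0,1,2,\ldots\}$, $[n]=\{1,\ldots,n\}$ (with $[0]=\emptyset$), and $A'=\{a':a\in A\}$, $A''=\{a'':a\in A\}$ for $A\subseteq\mathbb N$. For $m,n\in\mathbb N$, $\mathcal B_{mn}$ is the set of all Brauer partitions, i.e. set partitions of $[m]\cup[n]'$ into blocks of size $2$. For $\alpha\in\mathcal B_{mn}$ and $\beta\in\mathcal B_{nk}$, the product $\alpha\beta\in\mathcal B_{mk}$ is formed as follows: view partitions as graphs whose connected components are the blocks; let $\alpha_\downarrow$ be the graph on $[m]\cup[n]''$ obtained from $\alpha$ by renaming each $x'$ to $x''$, let $\beta^\uparrow$ be the graph on $[n]''\cup[k]'$ obtained from $\beta$ by renaming each $x\in[n]$ to $x''$, and let $\Pi(\alpha,\beta)$ be the union of these graphs on $[m]\cup[n]''\cup[k]'$; two elements of $[m]\cup[k]'$ lie in the same block of $\alpha\beta$ iff they lie in the same connected component of $\Pi(\alpha,\beta)$. The rank of a partition $\alpha\in\mathcal B_{mn}$ is the number of blocks of $\alpha$ meeting both $[m]$ and $[n]'$. For $\sigma\in\mathcal B_{nm}$, the sandwich semigroup $\mathcal B_{mn}^\sigma$ is the set $\mathcal B_{mn}$ with the associative operation $\alpha\star_\sigma\beta=\alpha\sigma\beta$.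 The rank of a semigroup $T$, $\operatorname{rank}(T)$, is the minimum size of a generating set for $T$ (as a semigroup). For odd $k\ge 1$, $k!!=k(k-2)\cdots3\cdot1$. *)

theory Defs
  imports Main "HOL-Library.Disjoint_Sets"
begin

text \<open>The constructors stand for \<open>x\<close>, \<open>x'\<close> and \<open>x''\<close>.\<close>

datatype vertex = Upper nat | Lower nat | Middle nat

definition uppers :: "nat \<Rightarrow> vertex set" where
  "uppers m = Upper ` {1..m}"

definition lowers :: "nat \<Rightarrow> vertex set" where
  "lowers n = Lower ` {1..n}"

definition brauer :: "nat \<Rightarrow> nat \<Rightarrow> vertex set set set" where
  "brauer m n = {\<alpha>. partition_on (uppers m \<union> lowers n) \<alpha> \<and> (\<forall>B\<in>\<alpha>. card B = 2)}"

fun lower_to_middle :: "vertex \<Rightarrow> vertex" where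
  "lower_to_middle (Upper x) = Upper x"
| "lower_to_middle (Lower x) = Middle x"
| "lower_to_middle (Middle x) = Middle x"

fun upper_to_middle :: "vertex \<Rightarrow> vertex" where
  "upper_to_middle (Upper x) = Middle x"
| "upper_to_middle (Lower x) = Lower x"
| "upper_to_middle (Middle x) = Middle x"

text \<open>A partition is viewed as the graph in which any two elements of a block are adjacent.\<close>

definition partition_edges :: "vertex set set \<Rightarrow> vertex rel" where
  "partition_edges \<alpha> = {(x, y). \<exists>B\<in>\<alpha>. x \<in> B \<and> y \<in> B}"

definition product_graph :: "vertex set set \<Rightarrow> vertex set set \<Rightarrow> vertex rel" where
  "product_graph \<alpha> \<beta> =
     map_prod lower_to_middle lower_to_middle ` partition_edges \<alpha> \<union>
     map_prod upper_to_middle upper_to_middle ` partition_edges \<beta>"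

text \<open>For \<open>\<alpha> \<in> brauer m n\<close> and \<open>\<beta> \<in> brauer n k\<close>, the product \<open>\<alpha>\<beta> \<in> brauer m k\<close> is
  \<open>brauer_mult m k \<alpha> \<beta>\<close>. The edge relation of the graph is symmetric, so its reflexive
  transitive closure relates exactly the vertices in a common connected component.\<close>

definition brauer_mult :: "nat \<Rightarrow> nat \<Rightarrow> vertex set set \<Rightarrow> vertex set set \<Rightarrow> vertex set set" where
  "brauer_mult m k \<alpha> \<beta> =
     (uppers m \<union> lowers k) //
       {(x, y). x \<in> uppers m \<union> lowers k \<and> y \<in> uppers m \<union> lowers k \<and>
                (x, y) \<in> (product_graph \<alpha> \<beta>)\<^sup>*}"

definition brauer_rank :: "nat \<Rightarrow> nat \<Rightarrow> vertex set set \<Rightarrow> nat" where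
  "brauer_rank m n \<alpha> = card {B \<in> \<alpha>. B \<inter> uppers m \<noteq> {} \<and> B \<inter> lowers n \<noteq> {}}"

definition sandwich_mult ::
  "nat \<Rightarrow> nat \<Rightarrow> vertex set set \<Rightarrow> vertex set set \<Rightarrow> vertex set set \<Rightarrow> vertex set set" where
  "sandwich_mult m n \<sigma> \<alpha> \<beta> = brauer_mult m n (brauer_mult m m \<alpha> \<sigma>) \<beta>"

inductive_set subsemigroup_gen :: "('a \<Rightarrow> 'a \<Rightarrow> 'a) \<Rightarrow> 'a set \<Rightarrow> 'a set"
  for f :: "'a \<Rightarrow> 'a \<Rightarrow> 'a" and A :: "'a set" where
  base: "a \<in> A \<Longrightarrow> a \<in> subsemigroup_gen f A"
| mult: "a \<in> subsemigroup_gen f A \<Longrightarrow> b \<in> subsemigroup_gen f A \<Longrightarrow> f a b \<in> subsemigroup_gen f A"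

text \<open>The rank of the semigroup with carrier \<open>S\<close> and operation \<open>f\<close>. It is meaningful only if
  \<open>S\<close> is finitely generated, as is the case when \<open>S\<close> is finite.\<close>

definition semigroup_rank :: "'a set \<Rightarrow> ('a \<Rightarrow> 'a \<Rightarrow> 'a) \<Rightarrow> nat" where
  "semigroup_rank S f =
     (LEAST k. \<exists>A. A \<subseteq> S \<and> finite A \<and> card A = k \<and> subsemigroup_gen f A = S)"

fun double_fact :: "nat \<Rightarrow> nat" where
  "double_fact 0 = 1"
| "double_fact (Suc 0) = 1"
| "double_fact (Suc (Suc k)) = Suc (Suc k) * double_fact k"

end

theory Submission
  imports Defs "HOL-Combinatorics.Permutations"
begin

text \<open>
  Call the set of upper hooks of an element of \<open>brauer m n\<close> of rank \<open>n\<close> its kernel. The kernels are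
  the perfect matchings of the subsets of \<open>[m]\<close> of size \<open>m - n\<close>, and there are
  \<open>(m choose n) (m - n - 1)!!\<close> of them (\<open>card_kernels\<close>, \<open>upper_hooks_full_rank\<close>). The theorem
  says that a minimal generating set has one element for each kernel.

  Lower bound: a product of rank \<open>n\<close> has the same kernel as its left factor, which is again of rank
  \<open>n\<close>, so each kernel occurs among the generators (\<open>subsemigroup_upper_hooks\<close>).

  Upper bound: since \<open>\<sigma>\<close> has rank \<open>n\<close>, the product \<open>\<alpha>\<sigma>\<beta>\<close> is \<open>\<alpha>(\<sigma>\<beta>)\<close> with \<open>\<sigma>\<beta>\<close> in \<open>brauer n n\<close>
  (\<open>brauer_mult_assoc_of_transversals\<close>). As \<open>n < m\<close>, the partition \<open>\<sigma>\<close> has a lower hook, and with its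
  help one finds \<open>n\<close> elements \<open>\<beta>\<close> of rank \<open>n\<close> with distinct kernels (none are needed if \<open>n < 2\<close>)
  such that the \<open>\<sigma>\<beta>\<close> are the transpositions \<open>(1 i)\<close> and a partition with one hook in each row
  (\<open>special_generators\<close>). Complete them by one arbitrary element for each remaining kernel. Right
  multiplication by transpositions then yields all elements of rank \<open>n\<close>, and right multiplication by
  the hook partition lowers the rank step by step to reach all other elements
  (\<open>generated_eq_brauer\<close>).

  Products are computed from the fact that a product of Brauer partitions has blocks of size
  two (\<open>brauer_mult_closed\<close>), which is a statement about orbits of two involutions
  (\<open>orbit_of_two_involutions\<close>): once this is known, exhibiting paths in the product graph suffices.
\<close>

section \<open>Orbits of two involutions\<close>

text \<open>Let \<open>f\<close> and \<open>g\<close> be involutions, \<open>R\<close> a relation whose components are the orbits of the group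
  they generate, and \<open>x\<close> a point fixed by \<open>g\<close> only. Then the orbit of \<open>x\<close> contains exactly
  one more point fixed by \<open>f\<close> or by \<open>g\<close>: it is the path that starts at \<open>x\<close>, and the other point
  is its far end. With \<open>c k = (g \<circ> f)\<^sup>k x\<close>, indices taken modulo the period \<open>N\<close>, the involutions act
  as the reflections \<open>f (c k) = c (-1 - k)\<close> and \<open>g (c k) = c (-k)\<close>, so that the fixed points
  are \<open>c 0\<close> and \<open>c (N div 2)\<close>.\<close>

lemma orbit_of_two_involutions:
  fixes f g :: "'a \<Rightarrow> 'a"
  assumes f: "\<And>v. f (f v) = v" and g: "\<And>v. g (g v) = v"
    and V: "finite V" "x \<in> V" "\<And>v. v \<in> V \<Longrightarrow> f v \<in> V" "\<And>v. v \<in> V \<Longrightarrow> g v \<in> V"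
    and x: "g x = x" "f x \<noteq> x"
    and R: "\<And>u v. (u, v) \<in> R \<Longrightarrow> v = u \<or> v = f u \<or> v = g u"
    and Rf: "\<And>v. v \<in> V \<Longrightarrow> (v, f v) \<in> R\<^sup>*" and Rg: "\<And>v. v \<in> V \<Longrightarrow> (v, g v) \<in> R\<^sup>*"
  obtains y where "y \<noteq> x" "{z \<in> V. (x, z) \<in> R\<^sup>* \<and> (f z = z \<or> g z = z)} = {x, y}"
proof -
  define p where "p = g \<circ> f"
  define c where "c k = (p ^^ k) x" for k
  have c0: "c 0 = x" and cS: "c (Suc k) = g (f (c k))" for k
    by (simp_all add: c_def p_def)
  have cV: "c k \<in> V" for k
    by (induction k) (simp_all add: c0 cS V)
  have injp: "inj p"
    by (rule injI) (metis comp_apply f g p_def)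
  have "finite {y. \<exists>k. y = c k}"
    by (rule finite_subset[OF _ V(1)]) (auto simp: cV)
  hence "\<exists>k>0. c k = x"
    using funpow_inj_finite[OF injp, of x] unfolding c_def by metis
  define N where "N = (LEAST k. 0 < k \<and> c k = x)"
  have N: "0 < N" "c N = x"
    using LeastI_ex[OF \<open>\<exists>k>0. c k = x\<close>] by (auto simp: N_def)
  have Nmin: "c k \<noteq> x" if "0 < k" "k < N" for k
    using not_less_Least[of k "\<lambda>k. 0 < k \<and> c k = x"] that by (auto simp: N_def)
  \<comment> \<open>period one would make \<open>f\<close> fix \<open>x\<close> as well\<close>
  have "N \<noteq> 1"
    using N x cS[of 0] c0 by (metis One_nat_def g)
  with N have N2: "2 \<le> N" by linarith
  have cinj: "i = j" if "c i = c j" "i < N" "j < N" for i j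
  proof -
    have *: "i = j" if "i \<le> j" "c i = c j" "j < N" for i j
    proof -
      have "(p ^^ i) (c (j - i)) = (p ^^ i) x"
        using that by (simp add: c_def flip: funpow_add comp_apply[of "p ^^ i" "p ^^ (j - i)"])
      hence "c (j - i) = x"
        using injp by (meson inj_fn injD)
      moreover have "j - i < N" using that by linarith
      ultimately have "\<not> 0 < j - i" using Nmin by blast
      thus ?thesis using that by simp
    qed
    show ?thesis
      using *[of i j] *[of j i] that by (cases "i \<le> j") auto
  qed
  have fc: "f (c k) = c (N - 1 - k)" if "k < N" for k
    using that
  proof (induction k)
    case 0
    have "g (f (c (N - 1))) = x"
      using cS[of "N - 1"] N by simp
    thus ?case using x c0 f g by (metis diff_zero)
  next
    case (Suc k)
    have "f (c (Suc k)) = f (g (f (c k)))" by (simp add: cS)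
    also have "f (c k) = c (Suc (N - 1 - Suc k))"
      using Suc by (metis Suc_diff_Suc Suc_lessD Suc_lessE diff_Suc_1)
    finally show ?case by (simp add: cS f g)
  qed
  have gc: "g (c (Suc k)) = c (N - 1 - k)" if "k < N" for k
    using fc[OF that] by (simp add: cS g)
  have reach: "(x, c k) \<in> R\<^sup>*" for k
  proof (induction k)
    case (Suc k)
    thus ?case using Rf[OF cV[of k]] Rg[OF V(3)[OF cV[of k]]] by (simp add: cS)
  qed (simp add: c0)
  have reached: "\<exists>k<N. z = c k" if "(x, z) \<in> R\<^sup>*" for z
    using that
  proof induction
    case base
    thus ?case using N c0 by metis
  next
    case (step y z)
    then obtain k where k: "k < N" "y = c k" by blast
    have "f y = c (N - 1 - k)" "N - 1 - k < N" using k fc by auto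
    moreover have "\<exists>i<N. g y = c i"
    proof (cases k)
      case 0
      thus ?thesis using k N x c0 by metis
    next
      case (Suc i)
      thus ?thesis using k gc[of i] by (intro exI[of _ "N - 1 - i"]) auto
    qed
    ultimately show ?case using R[OF step(2)] k by metis
  qed
  show ?thesis
  proof (rule that[of "c (N div 2)"])
    show "c (N div 2) \<noteq> x" using N2 by (intro Nmin) auto
    show "{z \<in> V. (x, z) \<in> R\<^sup>* \<and> (f z = z \<or> g z = z)} = {x, c (N div 2)}"
    proof (intro equalityI subsetI)
      fix z assume z: "z \<in> {z \<in> V. (x, z) \<in> R\<^sup>* \<and> (f z = z \<or> g z = z)}"
      then obtain k where k: "k < N" "z = c k" using reached by blast
      show "z \<in> {x, c (N div 2)}"
      proof (cases "k = 0")
        case False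
        then obtain i where i: "k = Suc i" by (cases k) auto
        have "k = N div 2"
        proof (cases "f z = z")
          case True
          hence "N - 1 - k = k" using k by (intro cinj) (auto simp: fc)
          thus ?thesis using k by linarith
        next
          case False
          hence "g (c (Suc i)) = c (Suc i)" using z k i by auto
          hence "N - 1 - i = Suc i" using k i gc[of i] by (intro cinj) auto
          thus ?thesis using k i by linarith
        qed
        thus ?thesis using k by simp
      qed (use k c0 in simp)
    next
      have "f (c (N div 2)) = c (N div 2) \<or> g (c (N div 2)) = c (N div 2)"
      proof (cases "even N")
        case True
        then obtain i where i: "N = 2 * Suc i" using N2 by (metis Suc_diff_1 dvdE mult_is_0 neq0_conv not_less0 N(1))
        have "N - 1 - i = Suc i" using i by simp
        thus ?thesis using gc[of i] i by simp
      next
        case False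
        hence "N - 1 - N div 2 = N div 2" by presburger
        thus ?thesis using fc[of "N div 2"] N by simp
      qed
      thus "z \<in> {z \<in> V. (x, z) \<in> R\<^sup>* \<and> (f z = z \<or> g z = z)}" if "z \<in> {x, c (N div 2)}" for z
        using that cV reach V x by auto
    qed
  qed
qed

section \<open>Perfect matchings\<close>

text \<open>The perfect matchings of \<open>U\<close>: the partitions of \<open>U\<close> into blocks of size two.\<close>

definition perfect_matchings :: "'a set \<Rightarrow> 'a set set set" where
  "perfect_matchings U = {M. partition_on U M \<and> (\<forall>B\<in>M. card B = 2)}"

lemma brauer_eq: "brauer m n = perfect_matchings (uppers m \<union> lowers n)"
  by (simp add: brauer_def perfect_matchings_def)

lemma matching_block:
  assumes "M \<in> perfect_matchings U" "B \<in> M"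
  obtains u v where "B = {u, v}" "u \<noteq> v" "u \<in> U" "v \<in> U"
proof -
  obtain u v where "B = {u, v}" "u \<noteq> v"
    using assms by (auto simp: perfect_matchings_def card_2_iff)
  moreover have "B \<subseteq> U" using assms by (auto simp: perfect_matchings_def partition_on_def)
  ultimately show ?thesis using that by auto
qed

lemma matching_vertices:
  assumes "M \<in> perfect_matchings U" "{u, v} \<in> M"
  shows "u \<in> U" "v \<in> U" "u \<noteq> v"
  using matching_block[OF assms] by (auto simp: doubleton_eq_iff)

lemma matching_partner:
  assumes "M \<in> perfect_matchings U" "u \<in> U"
  obtains v where "{u, v} \<in> M"
proof -
  obtain B where B: "B \<in> M" "u \<in> B"
    using assms by (auto simp: perfect_matchings_def partition_on_def)
  then obtain a b where "B = {a, b}" using matching_block[OF assms(1)] by metis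
  thus ?thesis using B that[of a] that[of b] by (auto simp: insert_commute)
qed

lemma matching_unique_block:
  assumes "M \<in> perfect_matchings U" "B \<in> M" "C \<in> M" "u \<in> B" "u \<in> C"
  shows "B = C"
  using assms by (auto simp: perfect_matchings_def partition_on_def disjoint_def)

lemma matching_unique:
  assumes "M \<in> perfect_matchings U" "{u, v} \<in> M" "{u, w} \<in> M"
  shows "v = w"
  using matching_unique_block[OF assms, of u] by (auto simp: doubleton_eq_iff)

text \<open>Every identity between products below is reduced by this lemma to one inclusion: it is enough
  to connect, in the product graph, the two ends of each block of the expected result.\<close>

lemma matching_subset_eq:
  assumes "M \<in> perfect_matchings U" "N \<in> perfect_matchings U" "M \<subseteq> N"
  shows "M = N"
proof (intro equalityI assms subsetI)
  fix B assume B: "B \<in> N"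
  then obtain u v where uv: "B = {u, v}" "u \<in> U" using matching_block[OF assms(2)] by metis
  obtain w where w: "{u, w} \<in> M" using matching_partner[OF assms(1) uv(2)] .
  thus "B \<in> M" using matching_unique_block[OF assms(2) B, of "{u, w}" u] assms(3) uv by auto
qed

lemma matchingI:
  assumes "\<And>B. B \<in> M \<Longrightarrow> \<exists>u v. B = {u, v} \<and> u \<noteq> v" "\<Union>M = U"
    and "\<And>B C u. B \<in> M \<Longrightarrow> C \<in> M \<Longrightarrow> u \<in> B \<Longrightarrow> u \<in> C \<Longrightarrow> B = C"
  shows "M \<in> perfect_matchings U"
  using assms by (fastforce simp: perfect_matchings_def partition_on_def disjoint_def card_2_iff)

lemma matching_Union: "M \<in> perfect_matchings U \<Longrightarrow> \<Union>M = U"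
  by (simp add: perfect_matchings_def partition_on_def)

lemma matching_image:
  assumes "M \<in> perfect_matchings U" "inj_on f U"
  shows "(`) f ` M \<in> perfect_matchings (f ` U)"
proof (rule matchingI)
  show "\<exists>u v. B = {u, v} \<and> u \<noteq> v" if "B \<in> (`) f ` M" for B
  proof -
    obtain C where C: "C \<in> M" "B = f ` C" using \<open>B \<in> (`) f ` M\<close> by auto
    obtain u v where uv: "C = {u, v}" "u \<noteq> v" "u \<in> U" "v \<in> U" using matching_block[OF assms(1) C(1)] .
    show ?thesis using C uv assms(2) by (intro exI[of _ "f u"] exI[of _ "f v"]) (auto dest: inj_onD)
  qed
  show "\<Union>((`) f ` M) = f ` U" using matching_Union[OF assms(1)] by auto
  show "B = C" if BC: "B \<in> (`) f ` M" "C \<in> (`) f ` M" "u \<in> B" "u \<in> C" for B C u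
  proof -
    obtain B' C' where *: "B' \<in> M" "B = f ` B'" "C' \<in> M" "C = f ` C'" using BC by auto
    then obtain b c where "b \<in> B'" "c \<in> C'" "u = f b" "u = f c" using BC by auto
    moreover have "b \<in> U" "c \<in> U" using * calculation matching_Union[OF assms(1)] by auto
    ultimately have "B' = C'"
      using matching_unique_block[OF assms(1) *(1,3), of b] assms(2) by (metis inj_onD)
    thus ?thesis using * by simp
  qed
qed

lemma matching_Un:
  assumes M: "M \<in> perfect_matchings U" and N: "N \<in> perfect_matchings W" and "U \<inter> W = {}"
  shows "M \<union> N \<in> perfect_matchings (U \<union> W)"
proof (rule matchingI)
  fix B assume "B \<in> M \<union> N"
  hence "card B = 2" using M N unfolding perfect_matchings_def by blast
  thus "\<exists>u v. B = {u, v} \<and> u \<noteq> v" unfolding card_2_iff by blast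
next
  show "\<Union>(M \<union> N) = U \<union> W"
    using matching_Union[OF M] matching_Union[OF N] by simp
next
  fix B C u assume *: "B \<in> M \<union> N" "C \<in> M \<union> N" "u \<in> B" "u \<in> C"
  have MU: "B \<in> M \<Longrightarrow> u \<in> B \<Longrightarrow> u \<in> U" "B \<in> N \<Longrightarrow> u \<in> B \<Longrightarrow> u \<in> W" for B
    using matching_Union[OF M] matching_Union[OF N] by blast+
  show "B = C"
    using * MU[of B] MU[of C] assms(3) matching_unique_block[OF M, of B C u] matching_unique_block[OF N, of B C u]
    by blast
qed

lemma matching_subset:
  assumes "M \<in> perfect_matchings U" "N \<subseteq> M"
  shows "N \<in> perfect_matchings (\<Union>N)"
  using assms by (auto simp: perfect_matchings_def partition_on_def disjoint_def subset_iff)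

lemma matching_Diff:
  assumes "M \<in> perfect_matchings U" "N \<subseteq> M"
  shows "M - N \<in> perfect_matchings (U - \<Union>N)"
proof -
  have "\<Union>(M - N) = U - \<Union>N"
    using assms matching_Union[OF assms(1)] matching_unique_block[OF assms(1)] by blast
  thus ?thesis using matching_subset[OF assms(1), of "M - N"] by auto
qed

lemma matching_doubleton: "u \<noteq> v \<Longrightarrow> {{u, v}} \<in> perfect_matchings {u, v}"
  by (rule matchingI) auto

lemma matching_finite: "M \<in> perfect_matchings U \<Longrightarrow> finite U \<Longrightarrow> finite M"
  using finite_elements by (auto simp: perfect_matchings_def)

lemma matching_card:
  assumes "M \<in> perfect_matchings U" "finite U"
  shows "card U = 2 * card M"
proof -
  have "card (\<Union>M) = sum card M"
    using assms by (intro card_Union_disjoint) 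
      (auto simp: perfect_matchings_def partition_on_def intro: card_ge_0_finite)
  also have "\<dots> = 2 * card M" using assms by (simp add: perfect_matchings_def)
  finally show ?thesis using matching_Union[OF assms(1)] by simp
qed

lemma finite_perfect_matchings: "finite U \<Longrightarrow> finite (perfect_matchings U)"
  by (rule finite_subset[of _ "Pow (Pow U)"]) (auto simp: perfect_matchings_def partition_on_def)

lemma perfect_matchings_insert:
  assumes "x \<notin> U"
  shows "perfect_matchings (insert x U) =
    (\<Union>y\<in>U. insert {x, y} ` perfect_matchings (U - {y}))"
proof (intro equalityI subsetI)
  fix M assume M: "M \<in> perfect_matchings (insert x U)"
  obtain y where y: "{x, y} \<in> M" using matching_partner[OF M] by blast
  have "y \<in> U" using matching_vertices[OF M y] by auto
  moreover have "M - {{x, y}} \<in> perfect_matchings (U - {y})"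
    using matching_Diff[OF M, of "{{x, y}}"] y assms by (simp add: insert_Diff_if)
  moreover have "M = insert {x, y} (M - {{x, y}})" using y by auto
  ultimately show "M \<in> (\<Union>y\<in>U. insert {x, y} ` perfect_matchings (U - {y}))" by blast
next
  fix M assume "M \<in> (\<Union>y\<in>U. insert {x, y} ` perfect_matchings (U - {y}))"
  then obtain y N where *: "y \<in> U" "N \<in> perfect_matchings (U - {y})" "M = insert {x, y} N" by auto
  have "{{x, y}} \<union> N \<in> perfect_matchings ({x, y} \<union> (U - {y}))"
    using assms * by (intro matching_Un matching_doubleton) auto
  moreover have "{x, y} \<union> (U - {y}) = insert x U" using * by auto
  ultimately show "M \<in> perfect_matchings (insert x U)" using * by simp
qed

lemma card_perfect_matchings:
  assumes "finite U" "even (card U)"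
  shows "card (perfect_matchings U) = double_fact (card U - 1)"
  using assms
proof (induction "card U" arbitrary: U rule: less_induct)
  case (less U)
  show ?case
  proof (cases "U = {}")
    case True
    have "perfect_matchings {} = {{} :: 'a set set}"
      by (auto simp: perfect_matchings_def partition_on_def)
    thus ?thesis using True by simp
  next
    case False
    then obtain x W where U: "U = insert x W" "x \<notin> W" by (metis Set.set_insert equals0I)
    have finW: "finite W" and cU: "card U = Suc (card W)" using less U by auto
    then obtain k where k: "card W = Suc (2 * k)" using less by (metis even_Suc oddE Suc_eq_plus1)
    let ?I = "\<lambda>y. insert {x, y} ` perfect_matchings (W - {y})"
    have x_in: "x \<notin> B" if "N \<in> perfect_matchings (W - {y})" "B \<in> N" for N B y
      using matching_Union[OF that(1)] that(2) U by auto
    have "card (perfect_matchings U) = (\<Sum>y\<in>W. card (?I y))"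
      unfolding U(1) perfect_matchings_insert[OF U(2)]
    proof (intro card_UN_disjoint finW ballI impI)
      show "finite (?I y)" for y using finW by (simp add: finite_perfect_matchings)
      fix y z assume yz: "y \<in> W" "z \<in> W" "y \<noteq> z"
      show "?I y \<inter> ?I z = {}"
      proof safe
        fix N N' assume *: "N \<in> perfect_matchings (W - {y})" "N' \<in> perfect_matchings (W - {z})"
          "insert {x, y} N = insert {x, z} N'"
        hence "{x, y} \<in> insert {x, z} N'" by auto
        thus "insert {x, y} N \<in> {}" using yz x_in[OF *(2), of "{x, y}"] by (auto simp: doubleton_eq_iff)
      qed
    qed
    also have "\<dots> = (\<Sum>y\<in>W. double_fact (card W - 2))"
    proof (rule sum.cong)
      fix y assume y: "y \<in> W"
      have "inj_on (insert {x, y}) (perfect_matchings (W - {y}))"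
        using x_in by (intro inj_onI) (metis insertI1 insert_ident)
      hence "card (?I y) = card (perfect_matchings (W - {y}))" by (rule card_image)
      also have "\<dots> = double_fact (card (W - {y}) - 1)"
        using y finW k cU by (intro less(1)) auto
      finally show "card (?I y) = double_fact (card W - 2)"
        using y finW by (simp add: numeral_2_eq_2)
    qed simp
    also have "\<dots> = card W * double_fact (card W - 2)" by simp
    also have "\<dots> = double_fact (card U - 1)"
      using cU k by (cases k) auto
    finally show ?thesis .
  qed
qed

section \<open>Products of Brauer partitions\<close>

text \<open>The other element of the block of \<open>x\<close>; points outside the matched set are their own partners,
  which makes \<open>partner M\<close> an involution of the whole type whose fixed points are exactly the
  unmatched ones.\<close>

definition partner :: "'a set set \<Rightarrow> 'a \<Rightarrow> 'a" where
  "partner M x = (if x \<in> \<Union>M then THE y. {x, y} \<in> M else x)"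

lemma partner_eq:
  assumes "M \<in> perfect_matchings U" "{x, y} \<in> M"
  shows "partner M x = y"
proof -
  have "(THE y. {x, y} \<in> M) = y" using assms(2) matching_unique[OF assms(1)] by (intro the_equality) blast+
  thus ?thesis using assms by (auto simp: partner_def)
qed

lemma partner_outside: "M \<in> perfect_matchings U \<Longrightarrow> x \<notin> U \<Longrightarrow> partner M x = x"
  using matching_Union by (auto simp: partner_def)

lemma partner_edge:
  assumes "M \<in> perfect_matchings U" "x \<in> U"
  shows "{x, partner M x} \<in> M"
  using matching_partner[OF assms] partner_eq[OF assms(1)] by metis

lemma partner_partner:
  assumes "M \<in> perfect_matchings U"
  shows "partner M (partner M x) = x"
proof (cases "x \<in> U")
  case True
  have "{partner M x, x} \<in> M" using partner_edge[OF assms True] by (simp add: insert_commute)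
  thus ?thesis by (rule partner_eq[OF assms])
qed (simp add: partner_outside[OF assms])

lemma partner_fixed_iff:
  assumes "M \<in> perfect_matchings U"
  shows "partner M x = x \<longleftrightarrow> x \<notin> U"
  using partner_edge[OF assms, of x] partner_outside[OF assms, of x] matching_vertices(3)[OF assms, of x x] by auto

lemma partner_in:
  assumes "M \<in> perfect_matchings U" "x \<in> U"
  shows "partner M x \<in> U"
  using matching_vertices(2)[OF assms(1) partner_edge[OF assms]] .

lemma edges_partner:
  assumes "M \<in> perfect_matchings U" "(x, y) \<in> partition_edges M"
  shows "y = x \<or> y = partner M x"
proof -
  obtain B where B: "B \<in> M" "x \<in> B" "y \<in> B" using assms by (auto simp: partition_edges_def)
  obtain u v where "B = {u, v}" using matching_block[OF assms(1) B(1)] by metis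
  thus ?thesis using B partner_eq[OF assms(1), of x y] by (auto simp: insert_commute)
qed

lemma partner_in_edges:
  assumes "M \<in> perfect_matchings U" "x \<in> U"
  shows "(x, partner M x) \<in> partition_edges M"
  using partner_edge[OF assms] by (auto simp: partition_edges_def)

lemma map_prod_partition_edges:
  "map_prod h h ` partition_edges \<alpha> = partition_edges ((`) h ` \<alpha>)"
  unfolding partition_edges_def by (auto 4 4 simp: image_iff Bex_def)

text \<open>The middle row \<open>[n]''\<close> of a product graph.\<close>

definition middles :: "nat \<Rightarrow> vertex set" where
  "middles n = Middle ` {1..n}"

lemma lower_to_middle_simps:
  "lower_to_middle ` uppers m = uppers m" "lower_to_middle ` lowers n = middles n"
  "inj_on lower_to_middle (uppers m \<union> lowers n)"
  by (auto simp: uppers_def lowers_def middles_def image_iff inj_on_def)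

lemma upper_to_middle_simps:
  "upper_to_middle ` lowers m = lowers m" "upper_to_middle ` uppers n = middles n"
  "inj_on upper_to_middle (uppers m \<union> lowers n)"
  by (auto simp: uppers_def lowers_def middles_def image_iff inj_on_def)

lemma finite_uppers [simp]: "finite (uppers m)" "finite (lowers m)" "finite (middles m)"
  by (auto simp: uppers_def lowers_def middles_def)

lemma card_uppers [simp]: "card (uppers m) = m" "card (lowers m) = m"
  by (auto simp: uppers_def lowers_def card_image inj_on_def)

lemma vertex_mem [simp]:
  "Upper i \<in> uppers m \<longleftrightarrow> i \<in> {1..m}" "Lower i \<notin> uppers m" "Middle i \<notin> uppers m"
  "Lower i \<in> lowers m \<longleftrightarrow> i \<in> {1..m}" "Upper i \<notin> lowers m" "Middle i \<notin> lowers m"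
  "Middle i \<in> middles m \<longleftrightarrow> i \<in> {1..m}" "Lower i \<notin> middles m" "Upper i \<notin> middles m"
  by (auto simp: uppers_def lowers_def middles_def)

lemma disjoint_vertices [simp]:
  "uppers m \<inter> lowers n = {}" "lowers n \<inter> uppers m = {}" "uppers m \<inter> middles n = {}"
  "middles n \<inter> uppers m = {}" "middles m \<inter> lowers n = {}" "lowers n \<inter> middles m = {}"
  by (auto simp: uppers_def lowers_def middles_def)

lemma sym_partition_edges: "sym (partition_edges \<alpha>)"
  unfolding sym_def partition_edges_def by blast

lemma product_graph_sym: "sym ((product_graph \<alpha> \<beta>)\<^sup>*)"
  unfolding product_graph_def map_prod_partition_edges
  by (rule sym_rtrancl[OF sym_Un[OF sym_partition_edges sym_partition_edges]])

text \<open>The heart of closure. In the product graph, the blocks of \<open>\<alpha>\<close> and of \<open>\<beta>\<close> give two involutions; a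
  vertex of the outer rows is fixed by exactly one of them and a middle vertex by neither. So each
  component that meets the outer rows is a path between two of their vertices.\<close>

lemma product_class_card:
  assumes \<alpha>: "\<alpha> \<in> brauer m n" and \<beta>: "\<beta> \<in> brauer n k"
    and x: "x \<in> uppers m \<union> lowers k"
  shows "card {y \<in> uppers m \<union> lowers k. (x, y) \<in> (product_graph \<alpha> \<beta>)\<^sup>*} = 2"
proof -
  define \<alpha>' where "\<alpha>' = (`) lower_to_middle ` \<alpha>"
  define \<beta>' where "\<beta>' = (`) upper_to_middle ` \<beta>"
  define V where "V = uppers m \<union> middles n \<union> lowers k"
  let ?R = "product_graph \<alpha> \<beta>" and ?f = "partner \<alpha>'" and ?g = "partner \<beta>'"
  have \<alpha>': "\<alpha>' \<in> perfect_matchings (uppers m \<union> middles n)"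
    using matching_image[OF _ lower_to_middle_simps(3), of \<alpha> m n] \<alpha>
    by (simp add: \<alpha>'_def brauer_eq image_Un lower_to_middle_simps)
  have \<beta>': "\<beta>' \<in> perfect_matchings (middles n \<union> lowers k)"
    using matching_image[OF _ upper_to_middle_simps(3), of \<beta> n k] \<beta>
    by (simp add: \<beta>'_def brauer_eq image_Un upper_to_middle_simps)
  have R: "?R = partition_edges \<alpha>' \<union> partition_edges \<beta>'"
    by (simp add: product_graph_def map_prod_partition_edges \<alpha>'_def \<beta>'_def)
  have Rsub: "v = u \<or> v = ?f u \<or> v = ?g u" if "(u, v) \<in> ?R" for u v
    using that edges_partner[OF \<alpha>'] edges_partner[OF \<beta>'] by (auto simp: R)
  have Rsub': "v = u \<or> v = ?g u \<or> v = ?f u" if "(u, v) \<in> ?R" for u v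
    using Rsub[OF that] by blast
  have Rf: "(v, ?f v) \<in> ?R\<^sup>*" for v
    using partner_in_edges[OF \<alpha>', of v] partner_outside[OF \<alpha>', of v]
    by (cases "v \<in> uppers m \<union> middles n") (auto simp: R)
  have Rg: "(v, ?g v) \<in> ?R\<^sup>*" for v
    using partner_in_edges[OF \<beta>', of v] partner_outside[OF \<beta>', of v]
    by (cases "v \<in> middles n \<union> lowers k") (auto simp: R)
  have fV: "?f v \<in> V" if "v \<in> V" for v
  proof (cases "v \<in> uppers m \<union> middles n")
    case True
    show ?thesis using partner_in[OF \<alpha>' True] by (auto simp: V_def)
  next
    case False
    show ?thesis using partner_outside[OF \<alpha>' False] that by simp
  qed
  have gV: "?g v \<in> V" if "v \<in> V" for v
  proof (cases "v \<in> middles n \<union> lowers k")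
    case True
    show ?thesis using partner_in[OF \<beta>' True] by (auto simp: V_def)
  next
    case False
    show ?thesis using partner_outside[OF \<beta>' False] that by simp
  qed
  have finV: "finite V" and xV: "x \<in> V" using x by (auto simp: V_def)
  have set_eq: "{y \<in> uppers m \<union> lowers k. (x, y) \<in> ?R\<^sup>*}
      = {z \<in> V. (x, z) \<in> ?R\<^sup>* \<and> (?f z = z \<or> ?g z = z)}"
    by (auto simp: V_def partner_fixed_iff[OF \<alpha>'] partner_fixed_iff[OF \<beta>'] uppers_def lowers_def middles_def)
  show ?thesis
  proof (cases "x \<in> uppers m")
    case True
    hence "?g x = x" "?f x \<noteq> x"
      by (auto simp: partner_fixed_iff[OF \<alpha>'] partner_fixed_iff[OF \<beta>'] uppers_def)
    from orbit_of_two_involutions[of ?f ?g V x ?R, OF partner_partner[OF \<alpha>'] partner_partner[OF \<beta>']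
      finV xV fV gV this Rsub Rf Rg]
    obtain y where "y \<noteq> x" "{z \<in> V. (x, z) \<in> ?R\<^sup>* \<and> (?f z = z \<or> ?g z = z)} = {x, y}" .
    thus ?thesis unfolding set_eq by simp
  next
    case False
    hence "?f x = x" "?g x \<noteq> x"
      using x by (auto simp: partner_fixed_iff[OF \<alpha>'] partner_fixed_iff[OF \<beta>'] lowers_def)
    from orbit_of_two_involutions[of ?g ?f V x ?R, OF partner_partner[OF \<beta>'] partner_partner[OF \<alpha>']
      finV xV gV fV this Rsub' Rg Rf]
    obtain y where "y \<noteq> x" "{z \<in> V. (x, z) \<in> ?R\<^sup>* \<and> (?g z = z \<or> ?f z = z)} = {x, y}" .
    thus ?thesis unfolding set_eq by (simp add: disj_commute)
  qed
qed

lemma equiv_product: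
  "equiv E {(x, y). x \<in> E \<and> y \<in> E \<and> (x, y) \<in> (product_graph \<alpha> \<beta>)\<^sup>*}"
  using product_graph_sym[of \<alpha> \<beta>]
  by (intro equivI) (auto simp: refl_on_def sym_def trans_def)

lemma brauer_mult_closed:
  assumes "\<alpha> \<in> brauer m n" "\<beta> \<in> brauer n k"
  shows "brauer_mult m k \<alpha> \<beta> \<in> brauer m k"
proof -
  let ?E = "uppers m \<union> lowers k"
  let ?r = "{(x, y). x \<in> ?E \<and> y \<in> ?E \<and> (x, y) \<in> (product_graph \<alpha> \<beta>)\<^sup>*}"
  have "card B = 2" if "B \<in> ?E // ?r" for B
  proof -
    obtain x where x: "x \<in> ?E" "B = ?r `` {x}" using \<open>B \<in> ?E // ?r\<close> by (rule quotientE)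
    hence "B = {y \<in> ?E. (x, y) \<in> (product_graph \<alpha> \<beta>)\<^sup>*}" by auto
    thus ?thesis using product_class_card[OF assms x(1)] by simp
  qed
  thus ?thesis
    unfolding brauer_def brauer_mult_def
    using partition_on_quotient[OF equiv_product] by blast
qed

lemma brauer_mult_connected:
  assumes "{p, q} \<in> brauer_mult m k \<alpha> \<beta>"
  shows "(p, q) \<in> (product_graph \<alpha> \<beta>)\<^sup>*"
  using quotient_eq_iff[OF equiv_product assms[unfolded brauer_mult_def] assms[unfolded brauer_mult_def], of p q]
  by auto

lemma brauer_multI:
  assumes "\<alpha> \<in> brauer m n" "\<beta> \<in> brauer n k"
    and "p \<in> uppers m \<union> lowers k" "q \<in> uppers m \<union> lowers k" "p \<noteq> q"
    and "(p, q) \<in> (product_graph \<alpha> \<beta>)\<^sup>*"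
  shows "{p, q} \<in> brauer_mult m k \<alpha> \<beta>"
proof -
  let ?E = "uppers m \<union> lowers k"
  let ?C = "{y \<in> ?E. (p, y) \<in> (product_graph \<alpha> \<beta>)\<^sup>*}"
  have "{p, q} \<subseteq> ?C" using assms by auto
  hence "{p, q} = ?C"
    using product_class_card[OF assms(1-3)] assms(5) by (intro card_subset_eq) auto
  also have "\<dots> = {(x, y). x \<in> ?E \<and> y \<in> ?E \<and> (x, y) \<in> (product_graph \<alpha> \<beta>)\<^sup>*} `` {p}"
    using assms by auto
  finally show ?thesis unfolding brauer_mult_def using assms(3) by (metis (no_types, lifting) quotientI)
qed

section \<open>Hooks and ranks\<close>

text \<open>Upper and lower hooks are the blocks contained in the upper row \<open>[m]\<close>, respectively in the
  lower row \<open>[n]'\<close>; the remaining blocks are the transversals, counted by \<open>brauer_rank\<close>.\<close>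

definition upper_hooks :: "nat \<Rightarrow> vertex set set \<Rightarrow> vertex set set" where
  "upper_hooks m \<alpha> = {B \<in> \<alpha>. B \<subseteq> uppers m}"

definition lower_hooks :: "nat \<Rightarrow> vertex set set \<Rightarrow> vertex set set" where
  "lower_hooks n \<alpha> = {B \<in> \<alpha>. B \<subseteq> lowers n}"

lemma brauer_finite: "\<alpha> \<in> brauer m n \<Longrightarrow> finite \<alpha>"
  unfolding brauer_eq by (erule matching_finite) simp

lemma card_eq_sum_blocks:
  assumes "M \<in> perfect_matchings W" "finite W" "U \<subseteq> W"
  shows "card U = (\<Sum>B\<in>M. card (B \<inter> U))"
proof -
  have "U = (\<Union>B\<in>M. B \<inter> U)" using matching_Union[OF assms(1)] assms(3) by blast
  also have "card \<dots> = (\<Sum>B\<in>M. card (B \<inter> U))"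
  proof (intro card_UN_disjoint ballI impI)
    show "finite M" using assms matching_finite by blast
    show "finite (B \<inter> U)" for B using assms finite_subset by blast
    show "B \<inter> U \<inter> (C \<inter> U) = {}" if "B \<in> M" "C \<in> M" "B \<noteq> C" for B C
      using matching_unique_block[OF assms(1) that(1,2)] that(3) by blast
  qed
  finally show ?thesis .
qed

lemma block_counts:
  assumes "\<alpha> \<in> brauer m n"
  shows "m = brauer_rank m n \<alpha> + 2 * card (upper_hooks m \<alpha>)"
    and "n = brauer_rank m n \<alpha> + 2 * card (lower_hooks n \<alpha>)"
proof -
  let ?t = "\<lambda>B. B \<inter> uppers m \<noteq> {} \<and> B \<inter> lowers n \<noteq> {}"
  have pm: "\<alpha> \<in> perfect_matchings (uppers m \<union> lowers n)" using assms by (simp add: brauer_eq)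
  have fin: "finite \<alpha>" using brauer_finite[OF assms] .
  have count: "card {B \<in> \<alpha>. P B} = (\<Sum>B\<in>\<alpha>. if P B then 1 else 0)" for P
    using fin by (simp add: sum.If_cases Int_def)
  have cases: "(card (B \<inter> uppers m) = (if ?t B then 1 else 0) + 2 * (if B \<subseteq> uppers m then 1 else 0)) \<and>
     (card (B \<inter> lowers n) = (if ?t B then 1 else 0) + 2 * (if B \<subseteq> lowers n then 1 else 0))"
    if "B \<in> \<alpha>" for B
  proof -
    obtain u v where uv: "B = {u, v}" "u \<noteq> v" "u \<in> uppers m \<union> lowers n" "v \<in> uppers m \<union> lowers n"
      using matching_block[OF pm \<open>B \<in> \<alpha>\<close>] .
    show ?thesis
      using uv by (auto simp: uppers_def lowers_def Int_insert_left)
  qed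
  have "card (uppers m) = (\<Sum>B\<in>\<alpha>. (if ?t B then 1 else 0) + 2 * (if B \<subseteq> uppers m then 1 else 0))"
    using card_eq_sum_blocks[OF pm, of "uppers m"] cases by simp
  thus "m = brauer_rank m n \<alpha> + 2 * card (upper_hooks m \<alpha>)"
    by (simp only: sum.distrib card_uppers flip: sum_distrib_left)
      (simp only: brauer_rank_def upper_hooks_def count)
  have "card (lowers n) = (\<Sum>B\<in>\<alpha>. (if ?t B then 1 else 0) + 2 * (if B \<subseteq> lowers n then 1 else 0))"
    using card_eq_sum_blocks[OF pm, of "lowers n"] cases by simp
  thus "n = brauer_rank m n \<alpha> + 2 * card (lower_hooks n \<alpha>)"
    by (simp only: sum.distrib card_uppers flip: sum_distrib_left)
      (simp only: brauer_rank_def lower_hooks_def count)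
qed

lemma product_graph_left:
  "{u, v} \<in> \<alpha> \<Longrightarrow> (lower_to_middle u, lower_to_middle v) \<in> (product_graph \<alpha> \<beta>)\<^sup>*"
  unfolding product_graph_def partition_edges_def by (intro r_into_rtrancl) fastforce

lemma product_graph_right:
  "{u, v} \<in> \<beta> \<Longrightarrow> (upper_to_middle u, upper_to_middle v) \<in> (product_graph \<alpha> \<beta>)\<^sup>*"
  unfolding product_graph_def partition_edges_def by (intro r_into_rtrancl) fastforce

lemma product_graph_symD:
  "(u, v) \<in> (product_graph \<alpha> \<beta>)\<^sup>* \<Longrightarrow> (v, u) \<in> (product_graph \<alpha> \<beta>)\<^sup>*"
  by (rule symD[OF product_graph_sym])

text \<open>To transport connectivity along a vertex map \<open>f\<close>, it suffices to treat the two kinds of edges.\<close>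

lemma product_graph_map:
  assumes "\<And>B u v. B \<in> \<alpha> \<Longrightarrow> u \<in> B \<Longrightarrow> v \<in> B \<Longrightarrow> (f (lower_to_middle u), f (lower_to_middle v)) \<in> S\<^sup>*"
    and "\<And>B u v. B \<in> \<beta> \<Longrightarrow> u \<in> B \<Longrightarrow> v \<in> B \<Longrightarrow> (f (upper_to_middle u), f (upper_to_middle v)) \<in> S\<^sup>*"
    and "(x, y) \<in> (product_graph \<alpha> \<beta>)\<^sup>*"
  shows "(f x, f y) \<in> S\<^sup>*"
  using assms(3)
proof induction
  case (step y z)
  from step(2) consider B u v where "B \<in> \<alpha>" "u \<in> B" "v \<in> B" "y = lower_to_middle u" "z = lower_to_middle v"
    | B u v where "B \<in> \<beta>" "u \<in> B" "v \<in> B" "y = upper_to_middle u" "z = upper_to_middle v"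
    unfolding product_graph_def partition_edges_def by auto
  hence "(f y, f z) \<in> S\<^sup>*" using assms(1,2) by cases auto
  with step(3) show ?case by (rule rtrancl_trans)
qed simp

text \<open>Multiplication on the right keeps all upper hooks of the left factor.\<close>

lemma upper_hooks_mult:
  assumes "\<alpha> \<in> brauer m n" "\<beta> \<in> brauer n k"
  shows "upper_hooks m \<alpha> \<subseteq> upper_hooks m (brauer_mult m k \<alpha> \<beta>)"
proof
  fix B assume B: "B \<in> upper_hooks m \<alpha>"
  then obtain u v where "B = {u, v}" "u \<noteq> v"
    using matching_block[OF assms(1)[unfolded brauer_eq], of B] unfolding upper_hooks_def by blast
  with B have uv: "B = {u, v}" "u \<noteq> v" "u \<in> uppers m" "v \<in> uppers m"
    by (auto simp: upper_hooks_def)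
  have "lower_to_middle u = u" "lower_to_middle v = v" using uv by (auto simp: uppers_def)
  hence "(u, v) \<in> (product_graph \<alpha> \<beta>)\<^sup>*"
    using product_graph_left[of u v \<alpha> \<beta>] B uv by (simp add: upper_hooks_def)
  hence "{u, v} \<in> brauer_mult m k \<alpha> \<beta>" using uv by (intro brauer_multI[OF assms]) auto
  thus "B \<in> upper_hooks m (brauer_mult m k \<alpha> \<beta>)" using uv by (auto simp: upper_hooks_def)
qed

section \<open>Associativity and particular products\<close>

text \<open>Two vertex maps for comparing product graphs, where \<open>s j\<close> is the lower end of the transversal of
  \<open>\<sigma>\<close> that starts at \<open>j\<close>. The first maps the graph of \<open>\<alpha>(\<sigma>\<beta>)\<close> to that of \<open>(\<alpha>\<sigma>)\<beta>\<close> by sliding the middle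
  row along the transversals; the second maps the graph of \<open>\<sigma>\<beta>\<close> there, collapsing each
  transversal of \<open>\<sigma>\<close> to its lower end.\<close>

fun move_middle :: "(nat \<Rightarrow> nat) \<Rightarrow> vertex \<Rightarrow> vertex" where
  "move_middle s (Upper i) = Upper i"
| "move_middle s (Lower i) = Lower i"
| "move_middle s (Middle i) = Middle (s i)"

fun move_upper :: "(nat \<Rightarrow> nat) \<Rightarrow> vertex \<Rightarrow> vertex" where
  "move_upper s (Upper i) = Middle (s i)"
| "move_upper s (Lower i) = Lower i"
| "move_upper s (Middle i) = Middle i"

text \<open>Associativity in the case where every upper vertex of \<open>\<sigma>\<close> lies on a transversal. Each lower hook of
  \<open>\<sigma>\<close> is then a block of \<open>\<alpha>\<sigma>\<close>, and \<open>\<alpha>\<sigma>\<close> is otherwise \<open>\<alpha>\<close> with lower vertices slid along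
  transversals, so the ends of each edge of the graphs of \<open>\<sigma>\<beta>\<close> and \<open>\<alpha>(\<sigma>\<beta>)\<close> have connected images.\<close>

lemma brauer_mult_assoc_of_transversals:
  assumes \<sigma>: "\<sigma> \<in> brauer n m" and edges: "\<forall>j\<in>{1..n}. {Upper j, Lower (s j)} \<in> \<sigma>"
    and \<alpha>: "\<alpha> \<in> brauer l n" and \<beta>: "\<beta> \<in> brauer m k"
  shows "brauer_mult l k (brauer_mult l m \<alpha> \<sigma>) \<beta> = brauer_mult l k \<alpha> (brauer_mult n k \<sigma> \<beta>)"
proof -
  let ?\<alpha>\<sigma> = "brauer_mult l m \<alpha> \<sigma>" and ?\<sigma>\<beta> = "brauer_mult n k \<sigma> \<beta>"
  let ?G = "product_graph ?\<alpha>\<sigma> \<beta>"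
  note s = bspec[OF edges]
  note \<alpha>\<sigma> = brauer_mult_closed[OF \<alpha> \<sigma>] and \<sigma>\<beta> = brauer_mult_closed[OF \<sigma> \<beta>]
  note \<sigma>' = \<sigma>[unfolded brauer_eq] and \<alpha>' = \<alpha>[unfolded brauer_eq]
  have sm: "s j \<in> {1..m}" if "j \<in> {1..n}" for j
    using matching_vertices(2)[OF \<sigma>' s[OF that]] by simp
  have \<sigma>_edge: "(move_upper s (lower_to_middle u), move_upper s (lower_to_middle v)) \<in> ?G\<^sup>*"
    if B: "B \<in> \<sigma>" "u \<in> B" "v \<in> B" for B u v
  proof (cases "u = v")
    case False
    obtain u' v' where "B = {u', v'}" using matching_block[OF \<sigma>' B(1)] by metis
    hence uv: "{u, v} \<in> \<sigma>" using B False by (metis doubleton_eq_iff insertE singletonD)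
    note in_E = matching_vertices(1,2)[OF \<sigma>' uv]
    show ?thesis
    proof (cases "\<exists>j\<in>{1..n}. u = Upper j \<or> v = Upper j")
      case True
      then obtain j where j: "j \<in> {1..n}" "u = Upper j \<or> v = Upper j" by blast
      \<comment> \<open>a transversal of \<open>\<sigma>\<close> collapses to a single vertex\<close>
      have "{u, v} = {Upper j, Lower (s j)}"
        using matching_unique_block[OF \<sigma>' uv s[OF j(1)], of "Upper j"] j by auto
      thus ?thesis by (auto simp: doubleton_eq_iff)
    next
      case no_upper: False
      then obtain a b where ab: "u = Lower a" "v = Lower b"
        using in_E by (auto simp: uppers_def lowers_def)
      have "(Lower a, Lower b) \<in> (product_graph \<alpha> \<sigma>)\<^sup>*"
        using product_graph_right[OF uv] ab by simp
      hence "{u, v} \<in> ?\<alpha>\<sigma>"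
        using in_E ab False by (intro brauer_multI[OF \<alpha> \<sigma>]) auto
      from product_graph_left[OF this, of \<beta>] show ?thesis using ab by simp
    qed
  qed simp
  have \<beta>_edge: "(move_upper s (upper_to_middle u), move_upper s (upper_to_middle v)) \<in> ?G\<^sup>*"
    if "B \<in> \<beta>" "u \<in> B" "v \<in> B" for B u v
  proof -
    have "move_upper s (upper_to_middle w) = upper_to_middle w" for w by (cases w) auto
    moreover have "(upper_to_middle u, upper_to_middle v) \<in> ?G"
      unfolding product_graph_def partition_edges_def using that by fastforce
    ultimately show ?thesis by auto
  qed
  have \<sigma>\<beta>_edge: "(move_middle s (upper_to_middle u), move_middle s (upper_to_middle v)) \<in> ?G\<^sup>*"
    if B: "B \<in> ?\<sigma>\<beta>" "u \<in> B" "v \<in> B" for B u v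
  proof (cases "u = v")
    case False
    obtain u' v' where "B = {u', v'}" using matching_block[OF \<sigma>\<beta>[unfolded brauer_eq] B(1)] by metis
    hence uv: "{u, v} \<in> ?\<sigma>\<beta>" using B False by (metis doubleton_eq_iff insertE singletonD)
    note in_E = matching_vertices(1,2)[OF \<sigma>\<beta>[unfolded brauer_eq] uv]
    have *: "move_middle s (upper_to_middle w) = move_upper s w" if "w \<in> uppers n \<union> lowers k" for w
      using that by (auto simp: uppers_def lowers_def)
    show ?thesis
      using product_graph_map[OF \<sigma>_edge \<beta>_edge brauer_mult_connected[OF uv]]
        *[OF in_E(1)] *[OF in_E(2)] by simp
  qed simp
  have \<alpha>_edge: "(move_middle s (lower_to_middle u), move_middle s (lower_to_middle v)) \<in> ?G\<^sup>*"
    if B: "B \<in> \<alpha>" "u \<in> B" "v \<in> B" for B u v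
  proof (cases "u = v")
    case False
    obtain u' v' where "B = {u', v'}" using matching_block[OF \<alpha>' B(1)] by metis
    hence uv: "{u, v} \<in> \<alpha>" using B False by (metis doubleton_eq_iff insertE singletonD)
    note in_E = matching_vertices(1,2)[OF \<alpha>' uv]
    \<comment> \<open>the place of the vertex \<open>w\<close> of \<open>\<alpha>\<close> in \<open>\<alpha>\<sigma>\<close>\<close>
    define h where "h w = (case w of Lower i \<Rightarrow> Lower (s i) | _ \<Rightarrow> w)" for w
    have h: "h w \<in> uppers l \<union> lowers m \<and> (lower_to_middle w, h w) \<in> (product_graph \<alpha> \<sigma>)\<^sup>* \<and>
        lower_to_middle (h w) = move_middle s (lower_to_middle w)" if w: "w \<in> uppers l \<union> lowers n" for w
    proof (cases w)
      case (Lower i)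
      hence i: "i \<in> {1..n}" using w by simp
      show ?thesis using product_graph_right[OF s[OF i], of \<alpha>] sm[OF i] Lower by (simp add: h_def)
    qed (use w in \<open>auto simp: h_def\<close>)
    have conn: "(h u, h v) \<in> (product_graph \<alpha> \<sigma>)\<^sup>*"
      using h[OF in_E(1)] h[OF in_E(2)] product_graph_left[OF uv, of \<sigma>]
      by (meson product_graph_symD rtrancl_trans)
    show ?thesis
    proof (cases "h u = h v")
      case True
      thus ?thesis using h[OF in_E(1)] h[OF in_E(2)] by (metis rtrancl.rtrancl_refl)
    next
      case False
      have "{h u, h v} \<in> ?\<alpha>\<sigma>"
        using h[OF in_E(1)] h[OF in_E(2)] conn False by (intro brauer_multI[OF \<alpha> \<sigma>]) auto
      from product_graph_left[OF this, of \<beta>] show ?thesis using h[OF in_E(1)] h[OF in_E(2)] by simp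
    qed
  qed simp
  have "brauer_mult l k \<alpha> ?\<sigma>\<beta> \<subseteq> brauer_mult l k ?\<alpha>\<sigma> \<beta>"
  proof
    fix B assume B: "B \<in> brauer_mult l k \<alpha> ?\<sigma>\<beta>"
    then obtain p q where pq: "B = {p, q}" "p \<noteq> q" "p \<in> uppers l \<union> lowers k" "q \<in> uppers l \<union> lowers k"
      using matching_block[OF brauer_mult_closed[OF \<alpha> \<sigma>\<beta>, unfolded brauer_eq]] by metis
    have "move_middle s p = p" "move_middle s q = q" using pq by (auto simp: uppers_def lowers_def)
    hence "(p, q) \<in> ?G\<^sup>*"
      using product_graph_map[OF \<alpha>_edge \<sigma>\<beta>_edge brauer_mult_connected[OF B[unfolded pq(1)]]] by simp
    thus "B \<in> brauer_mult l k ?\<alpha>\<sigma> \<beta>"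
      using pq brauer_multI[OF \<alpha>\<sigma> \<beta>] by auto
  qed
  thus ?thesis
    using matching_subset_eq brauer_mult_closed[OF \<alpha> \<sigma>\<beta>] brauer_mult_closed[OF \<alpha>\<sigma> \<beta>]
    unfolding brauer_eq by metis
qed

fun permute_lower :: "(nat \<Rightarrow> nat) \<Rightarrow> vertex \<Rightarrow> vertex" where
  "permute_lower p (Upper i) = Upper i"
| "permute_lower p (Lower i) = Lower (p i)"
| "permute_lower p (Middle i) = Middle i"

text \<open>The action of a permutation on lower vertices. It is right multiplication by the Brauer partition
  with blocks \<open>{j, (p j)'}\<close> (\<open>brauer_mult_permutation\<close>).\<close>

definition relabel :: "(nat \<Rightarrow> nat) \<Rightarrow> vertex set set \<Rightarrow> vertex set set" where
  "relabel p \<alpha> = (`) (permute_lower p) ` \<alpha>"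

lemma permute_lower_id: "permute_lower id = id"
  by (rule ext) (case_tac x; simp)

lemma permute_lower_comp: "permute_lower p (permute_lower q x) = permute_lower (p \<circ> q) x"
  by (cases x) auto

lemma relabel_id: "relabel id \<alpha> = \<alpha>" "relabel (\<lambda>i. i) \<alpha> = \<alpha>"
  using permute_lower_id by (simp_all add: relabel_def id_def)

lemma relabel_comp: "relabel p (relabel q \<alpha>) = relabel (p \<circ> q) \<alpha>"
  by (simp add: relabel_def image_image permute_lower_comp)

lemma relabel_mem: "{u, v} \<in> \<alpha> \<Longrightarrow> {permute_lower p u, permute_lower p v} \<in> relabel p \<alpha>"
  unfolding relabel_def by (metis image_empty image_eqI image_insert)

lemma inj_permute_lower: "inj p \<Longrightarrow> inj (permute_lower p)"
  by (rule injI) (case_tac x; case_tac y; auto dest: injD)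

lemma relabel_brauer:
  assumes "\<alpha> \<in> brauer m n" "p permutes {1..n}"
  shows "relabel p \<alpha> \<in> brauer m n"
proof -
  have "permute_lower p ` uppers m = uppers m"
    by (auto simp: uppers_def image_iff)
  moreover have "permute_lower p ` lowers n = Lower ` p ` {1..n}"
    by (simp add: lowers_def image_image)
  ultimately have "permute_lower p ` (uppers m \<union> lowers n) = uppers m \<union> lowers n"
    using permutes_image[OF assms(2)] by (simp add: image_Un lowers_def)
  moreover have "inj_on (permute_lower p) (uppers m \<union> lowers n)"
    using inj_permute_lower[OF permutes_inj[OF assms(2)]] inj_on_subset by blast
  ultimately show ?thesis
    using matching_image[of \<alpha> "uppers m \<union> lowers n" "permute_lower p"] assms(1)
    by (simp add: brauer_eq relabel_def)
qed

lemma card_lower_hooks_relabel: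
  assumes "\<alpha> \<in> brauer m n" "p permutes {1..n}"
  shows "card (lower_hooks n (relabel p \<alpha>)) = card (lower_hooks n \<alpha>)"
proof -
  have inj: "inj (permute_lower p)" using inj_permute_lower permutes_inj assms(2) by blast
  have *: "permute_lower p ` B \<subseteq> lowers n \<longleftrightarrow> B \<subseteq> lowers n" for B
  proof -
    have "permute_lower p x \<in> lowers n \<longleftrightarrow> x \<in> lowers n" for x
      using permutes_in_image[OF assms(2)] by (cases x) auto
    thus ?thesis by blast
  qed
  have "lower_hooks n (relabel p \<alpha>) = (`) (permute_lower p) ` lower_hooks n \<alpha>"
  proof -
    have "lower_hooks n (relabel p \<alpha>) =
        (`) (permute_lower p) ` {B \<in> \<alpha>. permute_lower p ` B \<subseteq> lowers n}"
      unfolding lower_hooks_def relabel_def by blast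
    thus ?thesis unfolding * lower_hooks_def .
  qed
  moreover have "inj_on ((`) (permute_lower p)) (lower_hooks n \<alpha>)"
    using inj by (simp add: inj_on_def inj_image_eq_iff)
  ultimately show ?thesis by (simp add: card_image)
qed

lemma brauer_mult_permutation:
  assumes \<alpha>: "\<alpha> \<in> brauer m n" and \<pi>: "\<pi> \<in> brauer n n" and p: "p permutes {1..n}"
    and \<pi>p: "\<And>j. j \<in> {1..n} \<Longrightarrow> {Upper j, Lower (p j)} \<in> \<pi>"
  shows "brauer_mult m n \<alpha> \<pi> = relabel p \<alpha>"
proof -
  have "relabel p \<alpha> \<subseteq> brauer_mult m n \<alpha> \<pi>"
  proof
    fix B assume "B \<in> relabel p \<alpha>"
    then obtain C where C: "C \<in> \<alpha>" "B = permute_lower p ` C" by (auto simp: relabel_def)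
    obtain u v where uv: "C = {u, v}" "u \<noteq> v" "u \<in> uppers m \<union> lowers n" "v \<in> uppers m \<union> lowers n"
      using matching_block[OF \<alpha>[unfolded brauer_eq] C(1)] .
    have *: "permute_lower p w \<in> uppers m \<union> lowers n \<and>
        (lower_to_middle w, permute_lower p w) \<in> (product_graph \<alpha> \<pi>)\<^sup>*" if "w \<in> uppers m \<union> lowers n" for w
    proof (cases w)
      case (Lower i)
      hence i: "i \<in> {1..n}" using that by simp
      show ?thesis
        using product_graph_right[OF \<pi>p[OF i], of \<alpha>] Lower permutes_in_image[OF p, of i] i by simp
    qed (use that in auto)
    have "(lower_to_middle u, lower_to_middle v) \<in> (product_graph \<alpha> \<pi>)\<^sup>*"
      using C uv by (intro product_graph_left) simp
    hence "(permute_lower p u, permute_lower p v) \<in> (product_graph \<alpha> \<pi>)\<^sup>*"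
      using *[OF uv(3)] *[OF uv(4)] by (meson product_graph_symD rtrancl_trans)
    moreover have "permute_lower p u \<noteq> permute_lower p v"
      using uv(2) inj_permute_lower[OF permutes_inj[OF p]] by (simp add: inj_eq)
    ultimately show "B \<in> brauer_mult m n \<alpha> \<pi>"
      using C uv * brauer_multI[OF \<alpha> \<pi>] by simp
  qed
  thus ?thesis
    using matching_subset_eq relabel_brauer[OF \<alpha> p] brauer_mult_closed[OF \<alpha> \<pi>]
    unfolding brauer_eq by metis
qed

text \<open>Let \<open>\<eta>\<close> have the hooks \<open>{1, 2}\<close> and \<open>{1', 2'}\<close> and vertical transversals elsewhere. Every \<open>\<gamma>\<close> that has
  the lower hook \<open>{1', 2'}\<close> and some upper hook \<open>{p, q}\<close> is a product \<open>\<alpha>\<eta>\<close>, where \<open>\<alpha>\<close> arises from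
  \<open>\<gamma>\<close> by replacing these two hooks with the transversals \<open>{p, 1'}\<close> and \<open>{q, 2'}\<close>.\<close>

lemma brauer_mult_hook:
  assumes \<gamma>: "\<gamma> \<in> brauer m n" and \<eta>: "\<eta> \<in> brauer n n"
    and \<eta>1: "{Upper 1, Upper 2} \<in> \<eta>" and \<eta>2: "{Lower 1, Lower 2} \<in> \<eta>"
    and \<eta>j: "\<And>j. j \<in> {3..n} \<Longrightarrow> {Upper j, Lower j} \<in> \<eta>"
    and pq: "{p, q} \<in> \<gamma>" "p \<in> uppers m" "q \<in> uppers m" and low: "{Lower 1, Lower 2} \<in> \<gamma>"
  defines "\<alpha> \<equiv> (\<gamma> - {{p, q}, {Lower 1, Lower 2}}) \<union> ({{p, Lower 1}} \<union> {{q, Lower 2}})"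
  shows "\<alpha> \<in> brauer m n" "brauer_mult m n \<alpha> \<eta> = \<gamma>"
    "card (lower_hooks n \<gamma>) = Suc (card (lower_hooks n \<alpha>))"
proof -
  note \<gamma>' = \<gamma>[unfolded brauer_eq]
  have ne: "p \<noteq> q" using matching_vertices[OF \<gamma>' pq(1)] by simp
  have low_in: "Lower 1 \<in> lowers n" "Lower 2 \<in> lowers n" using matching_vertices[OF \<gamma>' low] by auto
  have sep: "p \<notin> lowers n" "q \<notin> lowers n" using pq by (auto simp: uppers_def)
  have "\<alpha> \<in> perfect_matchings
      ((uppers m \<union> lowers n - \<Union>{{p, q}, {Lower 1, Lower 2}}) \<union> ({p, Lower 1} \<union> {q, Lower 2}))"
    unfolding \<alpha>_def
  proof (intro matching_Un matching_Diff[OF \<gamma>'] matching_doubleton)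
    show "{{p, q}, {Lower 1, Lower 2}} \<subseteq> \<gamma>" using pq low by simp
    show "p \<noteq> Lower 1" "q \<noteq> Lower 2" "{p, Lower 1} \<inter> {q, Lower 2} = {}"
      using sep low_in ne by auto
    show "(uppers m \<union> lowers n - \<Union> {{p, q}, {Lower 1, Lower 2}}) \<inter> ({p, Lower 1} \<union> {q, Lower 2}) = {}"
      by auto
  qed
  also have "(uppers m \<union> lowers n - \<Union>{{p, q}, {Lower 1, Lower 2}}) \<union> ({p, Lower 1} \<union> {q, Lower 2})
      = uppers m \<union> lowers n"
    using pq(2,3) low_in by auto
  finally show \<alpha>: "\<alpha> \<in> brauer m n" unfolding brauer_eq .
  let ?G = "product_graph \<alpha> \<eta>"
  have lp: "lower_to_middle p = p" "lower_to_middle q = q" using pq by (auto simp: uppers_def)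
  have "\<gamma> \<subseteq> brauer_mult m n \<alpha> \<eta>"
  proof
    fix B assume B: "B \<in> \<gamma>"
    consider "B = {p, q}" | "B = {Lower 1, Lower 2}" | "B \<in> \<alpha>" "B \<noteq> {p, q}" "B \<noteq> {Lower 1, Lower 2}"
      using B by (auto simp: \<alpha>_def)
    thus "B \<in> brauer_mult m n \<alpha> \<eta>"
    proof cases
      case 1
      have "(p, Middle 1) \<in> ?G\<^sup>*" "(q, Middle 2) \<in> ?G\<^sup>*"
        using product_graph_left[of p "Lower 1" \<alpha> \<eta>] product_graph_left[of q "Lower 2" \<alpha> \<eta>]
        by (simp_all add: \<alpha>_def lp)
      moreover have "(Middle 1, Middle 2) \<in> ?G\<^sup>*"
        using product_graph_right[OF \<eta>1, of \<alpha>] by simp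
      ultimately have "(p, q) \<in> ?G\<^sup>*" by (meson product_graph_symD rtrancl_trans)
      thus ?thesis using 1 pq ne by (auto intro: brauer_multI[OF \<alpha> \<eta>])
    next
      case 2
      have "(Lower 1, Lower 2) \<in> ?G\<^sup>*" using product_graph_right[OF \<eta>2, of \<alpha>] by simp
      thus ?thesis using 2 low_in by (auto intro: brauer_multI[OF \<alpha> \<eta>])
    next
      case 3
      obtain u v where uv: "B = {u, v}" "u \<noteq> v" "u \<in> uppers m \<union> lowers n" "v \<in> uppers m \<union> lowers n"
        using matching_block[OF \<gamma>' B] .
      have notin: "Lower 1 \<notin> B" "Lower 2 \<notin> B"
        using matching_unique_block[OF \<gamma>' B low] 3 by auto
      have *: "(lower_to_middle w, w) \<in> ?G\<^sup>*" if w: "w \<in> B" for w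
      proof (cases w)
        case (Lower i)
        have "w \<in> uppers m \<union> lowers n" using w uv by auto
        hence "i \<in> {1..n}" "i \<noteq> 1" "i \<noteq> 2" using Lower w notin by auto
        hence "i \<in> {3..n}" by auto
        from product_graph_right[OF \<eta>j[OF this], of \<alpha>] show ?thesis using Lower by simp
      next
        case (Middle i)
        thus ?thesis using w uv by auto
      qed auto
      have "(lower_to_middle u, lower_to_middle v) \<in> ?G\<^sup>*"
        using 3 uv by (intro product_graph_left) simp
      hence "(u, v) \<in> ?G\<^sup>*" using *[of u] *[of v] uv(1)
        by (meson product_graph_symD rtrancl_trans insertI1 insertI2)
      thus ?thesis using uv brauer_multI[OF \<alpha> \<eta>] by auto
    qed
  qed
  thus "brauer_mult m n \<alpha> \<eta> = \<gamma>"
    using matching_subset_eq \<gamma> brauer_mult_closed[OF \<alpha> \<eta>] unfolding brauer_eq by metis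
  have "lower_hooks n \<gamma> = insert {Lower 1, Lower 2} (lower_hooks n \<alpha>)"
    using sep low low_in by (auto simp: lower_hooks_def \<alpha>_def)
  moreover have "{Lower 1, Lower 2} \<notin> lower_hooks n \<alpha>"
    using sep low_in by (auto simp: lower_hooks_def \<alpha>_def doubleton_eq_iff)
  ultimately show "card (lower_hooks n \<gamma>) = Suc (card (lower_hooks n \<alpha>))"
    using brauer_finite[OF \<alpha>] by (simp add: lower_hooks_def)
qed

section \<open>Kernels of partitions of full rank\<close>

text \<open>The elements of \<open>brauer m n\<close> of rank \<open>n\<close>, that is, without lower hooks.\<close>

definition full_rank :: "nat \<Rightarrow> nat \<Rightarrow> vertex set set set" where
  "full_rank m n = {\<alpha> \<in> brauer m n. lower_hooks n \<alpha> = {}}"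

text \<open>The perfect matchings of subsets of \<open>[m]\<close> of size \<open>m - n\<close>. They are exactly the sets of
  upper hooks of the elements of rank \<open>n\<close> (\<open>upper_hooks_full_rank\<close>).\<close>

definition kernels :: "nat \<Rightarrow> nat \<Rightarrow> vertex set set set" where
  "kernels m n = (\<Union>U\<in>{U. U \<subseteq> uppers m \<and> card U = m - n}. perfect_matchings U)"

lemma card_kernels:
  assumes "n \<le> m" "even (m - n)"
  shows "finite (kernels m n)" "card (kernels m n) = (m choose n) * double_fact (m - n - 1)"
proof -
  let ?\<U> = "{U. U \<subseteq> uppers m \<and> card U = m - n}"
  have fin: "finite U" if "U \<in> ?\<U>" for U using that finite_subset[of U "uppers m"] by simp
  have fin\<U>: "finite ?\<U>" by (rule finite_subset[of _ "Pow (uppers m)"]) auto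
  show "finite (kernels m n)"
    unfolding kernels_def using fin fin\<U> by (intro finite_UN_I finite_perfect_matchings) auto
  have "card (kernels m n) = (\<Sum>U\<in>?\<U>. card (perfect_matchings U))"
    unfolding kernels_def
  proof (intro card_UN_disjoint fin\<U> ballI impI)
    show "finite (perfect_matchings U)" if "U \<in> ?\<U>" for U
      using fin[OF that] by (rule finite_perfect_matchings)
    show "perfect_matchings U \<inter> perfect_matchings W = {}" if "U \<noteq> W" for U W :: "vertex set"
      using that by (auto dest!: matching_Union)
  qed
  also have "\<dots> = (\<Sum>U\<in>?\<U>. double_fact (m - n - 1))"
    using assms(2) fin by (intro sum.cong refl) (simp add: card_perfect_matchings)
  also have "\<dots> = (m choose (m - n)) * double_fact (m - n - 1)"
    by (simp add: n_subsets)
  finally show "card (kernels m n) = (m choose n) * double_fact (m - n - 1)"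
    using assms(1) binomial_symmetric by metis
qed

lemma full_rank_card_upper_hooks:
  assumes "\<alpha> \<in> full_rank m n"
  shows "m = n + 2 * card (upper_hooks m \<alpha>)"
  using block_counts[of \<alpha> m n] assms by (auto simp: full_rank_def)

lemma upper_hooks_matching:
  assumes "\<alpha> \<in> brauer m n"
  shows "upper_hooks m \<alpha> \<in> perfect_matchings (\<Union>(upper_hooks m \<alpha>))"
  using assms unfolding brauer_eq by (rule matching_subset) (auto simp: upper_hooks_def)

lemma upper_hooks_full_rank:
  assumes "n \<le> m"
  shows "upper_hooks m ` full_rank m n = kernels m n"
proof (intro equalityI subsetI)
  fix K assume "K \<in> upper_hooks m ` full_rank m n"
  then obtain \<alpha> where \<alpha>: "\<alpha> \<in> full_rank m n" "K = upper_hooks m \<alpha>" by auto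
  have sub: "\<Union>K \<subseteq> uppers m" using \<alpha> by (auto simp: upper_hooks_def)
  have pm: "K \<in> perfect_matchings (\<Union>K)"
    using upper_hooks_matching[of \<alpha> m n] \<alpha> by (simp add: full_rank_def)
  have "finite (\<Union>K)" using sub finite_subset by (metis finite_uppers(1))
  hence "card (\<Union>K) = m - n"
    using matching_card[OF pm] full_rank_card_upper_hooks[OF \<alpha>(1)] \<alpha>(2) by simp
  thus "K \<in> kernels m n" using pm sub by (auto simp: kernels_def)
next
  fix K assume "K \<in> kernels m n"
  then obtain U where U: "U \<subseteq> uppers m" "card U = m - n" and K: "K \<in> perfect_matchings U"
    by (auto simp: kernels_def)
  show "K \<in> upper_hooks m ` full_rank m n"
  proof -
    let ?W = "uppers m - U"
    have "card ?W = card (lowers n)"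
      using U assms by (simp add: card_Diff_subset[OF finite_subset[OF U(1)]])
    then obtain e where e: "bij_betw e ?W (lowers n)"
      using finite_same_card_bij[of ?W "lowers n"] by auto
    have e_low: "e u \<in> lowers n" if "u \<in> ?W" for u using bij_betwE[OF e] that by blast
    have e_inj: "u = v" if "u \<in> ?W" "v \<in> ?W" "e u = e v" for u v
      using bij_betw_imp_inj_on[OF e] that by (meson inj_onD)
    have apart: "u \<noteq> v" if "u \<in> ?W" "v \<in> lowers n" for u v
      using that by (auto simp: uppers_def lowers_def)
    define L where "L = (\<lambda>u. {u, e u}) ` ?W"
    have L: "L \<in> perfect_matchings (?W \<union> lowers n)"
    proof (rule matchingI)
      show "\<exists>u v. B = {u, v} \<and> u \<noteq> v" if "B \<in> L" for B
        using that e_low apart unfolding L_def by blast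
      show "\<Union>L = ?W \<union> lowers n"
        unfolding L_def bij_betw_imp_surj_on[OF e, symmetric] by blast
      show "B = C" if BC: "B \<in> L" "C \<in> L" "u \<in> B" "u \<in> C" for B C u
      proof -
        obtain b c where "b \<in> ?W" "B = {b, e b}" "c \<in> ?W" "C = {c, e c}"
          using BC unfolding L_def by blast
        moreover from this have "b = c" using BC(3,4) e_inj e_low apart by blast
        ultimately show ?thesis by simp
      qed
    qed
    have W: "U \<union> (?W \<union> lowers n) = uppers m \<union> lowers n" using U by blast
    have "U \<inter> (?W \<union> lowers n) = {}" using U(1) disjoint_vertices(1)[of m n] by blast
    hence br: "K \<union> L \<in> brauer m n"
      using matching_Un[OF K L] unfolding W brauer_eq by simp
    have Kup: "B \<subseteq> uppers m \<and> B \<noteq> {}" if "B \<in> K" for B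
      using matching_Union[OF K] matching_block[OF K that] that U(1) by blast
    have Lmix: "\<not> B \<subseteq> uppers m \<and> \<not> B \<subseteq> lowers n" if "B \<in> L" for B
    proof -
      obtain u where u: "u \<in> ?W" "B = {u, e u}" using \<open>B \<in> L\<close> unfolding L_def by blast
      have "e u \<notin> uppers m" "u \<notin> lowers n"
        using u(1) e_low[OF u(1)] by (auto simp: uppers_def lowers_def)
      thus ?thesis using u(2) by simp
    qed
    have "upper_hooks m (K \<union> L) = K" using Kup Lmix by (auto simp: upper_hooks_def)
    moreover have "lower_hooks n (K \<union> L) = {}"
      unfolding lower_hooks_def using Kup Lmix disjoint_vertices(1)[of m n] by blast
    ultimately show ?thesis using br by (intro image_eqI[of _ _ "K \<union> L"]) (auto simp: full_rank_def)
  qed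
qed

lemma full_rank_same_hooks:
  assumes \<alpha>: "\<alpha> \<in> full_rank m n" and \<gamma>: "\<gamma> \<in> full_rank m n"
    and eq: "upper_hooks m \<alpha> = upper_hooks m \<gamma>"
  obtains p where "p permutes {1..n}" "\<gamma> = relabel p \<alpha>"
proof -
  have \<alpha>': "\<alpha> \<in> perfect_matchings (uppers m \<union> lowers n)" and \<gamma>': "\<gamma> \<in> perfect_matchings (uppers m \<union> lowers n)"
    using \<alpha> \<gamma> by (auto simp: full_rank_def brauer_eq)
  have ex: "\<exists>k u. k \<in> {1..n} \<and> {u, Lower i} \<in> \<alpha> \<and> {u, Lower k} \<in> \<gamma>" if i: "i \<in> {1..n}" for i
  proof -
    obtain u where u: "{Lower i, u} \<in> \<alpha>" using matching_partner[OF \<alpha>', of "Lower i"] i by auto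
    have u_up: "u \<in> uppers m"
      using matching_vertices[OF \<alpha>' u] u \<alpha> by (auto simp: full_rank_def lower_hooks_def)
    obtain w where w: "{u, w} \<in> \<gamma>" using matching_partner[OF \<gamma>', of u] u_up by auto
    have "w \<notin> uppers m"
    proof
      assume "w \<in> uppers m"
      hence "{u, w} \<in> upper_hooks m \<gamma>" using u_up w by (auto simp: upper_hooks_def)
      hence "{u, w} \<in> \<alpha>" using eq by (auto simp: upper_hooks_def)
      hence "w = Lower i" using matching_unique[OF \<alpha>', of u w "Lower i"] u by (simp add: insert_commute)
      thus False using \<open>w \<in> uppers m\<close> by simp
    qed
    then obtain k where "w = Lower k" "k \<in> {1..n}"
      using matching_vertices[OF \<gamma>' w] by (auto simp: lowers_def)
    thus ?thesis using u w by (auto simp: insert_commute)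
  qed
  then obtain q u where q: "\<And>i. i \<in> {1..n} \<Longrightarrow> q i \<in> {1..n} \<and> {u i, Lower i} \<in> \<alpha> \<and> {u i, Lower (q i)} \<in> \<gamma>"
    by metis
  define p where "p i = (if i \<in> {1..n} then q i else i)" for i
  have inj: "inj_on p {1..n}"
  proof (rule inj_onI)
    fix i j assume ij: "i \<in> {1..n}" "j \<in> {1..n}" "p i = p j"
    have "{Lower (q i), u i} \<in> \<gamma>" "{Lower (q i), u j} \<in> \<gamma>"
      using q[OF ij(1)] q[OF ij(2)] ij by (auto simp: p_def insert_commute)
    hence "u i = u j" by (rule matching_unique[OF \<gamma>'])
    hence "Lower i = Lower j" using q[OF ij(1)] q[OF ij(2)] matching_unique[OF \<alpha>', of "u i"] by metis
    thus "i = j" by simp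
  qed
  have "p ` {1..n} \<subseteq> {1..n}" using q by (auto simp: p_def)
  hence "p ` {1..n} = {1..n}" using inj by (intro endo_inj_surj) auto
  hence p: "p permutes {1..n}"
    using inj by (intro bij_imp_permutes) (auto simp: bij_betw_def p_def)
  have "relabel p \<alpha> \<subseteq> \<gamma>"
  proof
    fix B assume "B \<in> relabel p \<alpha>"
    then obtain C where C: "C \<in> \<alpha>" "B = permute_lower p ` C" by (auto simp: relabel_def)
    show "B \<in> \<gamma>"
    proof (cases "C \<subseteq> uppers m")
      case True
      hence "permute_lower p ` C = C" by (force simp: uppers_def image_iff)
      moreover have "C \<in> upper_hooks m \<gamma>" using True C eq by (auto simp: upper_hooks_def)
      ultimately show ?thesis using C by (simp add: upper_hooks_def)
    next
      case False
      then obtain i where i: "Lower i \<in> C" "i \<in> {1..n}"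
        using C matching_Union[OF \<alpha>'] unfolding lowers_def by blast
      have "C = {u i, Lower i}"
        using matching_unique_block[OF \<alpha>' C(1), of "{u i, Lower i}" "Lower i"] q[OF i(2)] i by simp
      moreover have "u i \<in> uppers m"
        using q[OF i(2)] matching_vertices(1)[OF \<alpha>', of "u i" "Lower i"] \<alpha> i(2)
        by (auto simp: full_rank_def lower_hooks_def)
      ultimately show ?thesis using q[OF i(2)] C i by (auto simp: uppers_def p_def)
    qed
  qed
  hence "relabel p \<alpha> = \<gamma>"
    using matching_subset_eq \<gamma>' relabel_brauer[OF _ p, of \<alpha> m] \<alpha>' unfolding brauer_eq by metis
  thus ?thesis using that p by blast
qed

section \<open>Generating all Brauer partitions\<close>

text \<open>The transpositions \<open>(1 i)\<close> generate all permutations of \<open>{1..n}\<close>.\<close>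

lemma relabel_closed_of_star_transpositions:
  assumes star: "\<And>\<alpha> i. \<alpha> \<in> T \<Longrightarrow> i \<in> {2..n} \<Longrightarrow> relabel (transpose 1 i) \<alpha> \<in> T"
    and p: "p permutes {1..n}" and \<alpha>: "\<alpha> \<in> T"
  shows "relabel p \<alpha> \<in> T"
  using p finite_atLeastAtMost[of 1 n]
proof (induction rule: permutes_induct)
  case id
  thus ?case using \<alpha> relabel_id by simp
next
  case (swap a b q)
  have star': "relabel (transpose 1 i) \<gamma> \<in> T" if "\<gamma> \<in> T" "i \<in> {1..n}" "i \<noteq> 1" for \<gamma> i
    using star[OF that(1), of i] that(2,3) by simp
  consider "a = 1" | "b = 1" | "a \<noteq> 1" "b \<noteq> 1" by blast
  hence "relabel (transpose a b) (relabel q \<alpha>) \<in> T"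
  proof cases
    case 1
    thus ?thesis using swap star' by auto
  next
    case 2
    thus ?thesis using swap star'[of "relabel q \<alpha>" a] by (simp add: transpose_commute)
  next
    case 3
    have "transpose 1 a \<circ> transpose 1 b \<circ> transpose 1 a = transpose a b"
      using transpose_comp_triple[of a b 1] 3 swap by (simp add: transpose_commute)
    moreover have "relabel (transpose 1 a) (relabel (transpose 1 b) (relabel (transpose 1 a) (relabel q \<alpha>))) \<in> T"
      using 3 swap by (intro star') auto
    ultimately show ?thesis by (metis relabel_comp)
  qed
  thus ?case unfolding relabel_comp .
qed

text \<open>A set containing one element of rank \<open>n\<close> for each kernel, and closed under right multiplication
  by the star transpositions and by \<open>\<eta>\<close>, is everything. Permuting lower vertices yields all elements
  of rank \<open>n\<close>. An element with lower hooks also has an upper hook because \<open>n < m\<close>; moving one of its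
  lower hooks to \<open>{1', 2'}\<close> makes it a multiple by \<open>\<eta>\<close> of an element with one lower hook fewer.\<close>

lemma generated_eq_brauer:
  assumes "n < m" and T: "T \<subseteq> brauer m n"
    and star: "\<And>\<alpha> i. \<alpha> \<in> T \<Longrightarrow> i \<in> {2..n} \<Longrightarrow> relabel (transpose 1 i) \<alpha> \<in> T"
    and \<eta>: "2 \<le> n \<Longrightarrow> \<eta> \<in> brauer n n" "2 \<le> n \<Longrightarrow> {Upper 1, Upper 2} \<in> \<eta>"
      "2 \<le> n \<Longrightarrow> {Lower 1, Lower 2} \<in> \<eta>" "\<And>j. j \<in> {3..n} \<Longrightarrow> {Upper j, Lower j} \<in> \<eta>"
    and hook: "\<And>\<alpha>. \<alpha> \<in> T \<Longrightarrow> 2 \<le> n \<Longrightarrow> brauer_mult m n \<alpha> \<eta> \<in> T"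
    and kern: "kernels m n \<subseteq> upper_hooks m ` (T \<inter> full_rank m n)"
  shows "T = brauer m n"
proof (intro equalityI T subsetI)
  have relabel_T: "relabel p \<alpha> \<in> T" if "p permutes {1..n}" "\<alpha> \<in> T" for p \<alpha>
    using star that by (rule relabel_closed_of_star_transpositions)
  fix \<gamma> assume "\<gamma> \<in> brauer m n"
  thus "\<gamma> \<in> T"
  proof (induction "card (lower_hooks n \<gamma>)" arbitrary: \<gamma>)
    case 0
    hence \<gamma>: "\<gamma> \<in> full_rank m n"
      using brauer_finite[OF 0(2)] by (auto simp: full_rank_def lower_hooks_def)
    hence "upper_hooks m \<gamma> \<in> kernels m n" using upper_hooks_full_rank[of n m] \<open>n < m\<close> by auto
    then obtain \<alpha> where \<alpha>: "\<alpha> \<in> T" "\<alpha> \<in> full_rank m n" "upper_hooks m \<alpha> = upper_hooks m \<gamma>"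
      using kern by force
    from full_rank_same_hooks[OF \<alpha>(2) \<gamma> \<alpha>(3)] obtain p where "p permutes {1..n}" "\<gamma> = relabel p \<alpha>" .
    thus ?case using relabel_T \<alpha>(1) by blast
  next
    case (Suc k)
    note pm = Suc(3)[unfolded brauer_eq]
    have "lower_hooks n \<gamma> \<noteq> {}" using Suc(2) by auto
    then obtain B where B: "B \<in> \<gamma>" "B \<subseteq> lowers n" by (auto simp: lower_hooks_def)
    obtain u v where uv: "B = {u, v}" "u \<noteq> v" using matching_block[OF pm B(1)] by metis
    then obtain i j where "u = Lower i" "v = Lower j" "i \<in> {1..n}" "j \<in> {1..n}"
      using B unfolding lowers_def by blast
    with uv B have ij: "{Lower i, Lower j} \<in> \<gamma>" "i \<noteq> j" "i \<in> {1..n}" "j \<in> {1..n}" by auto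
    hence n2: "2 \<le> n" by auto
    \<comment> \<open>a permutation that moves \<open>i\<close> to 1 and \<open>j\<close> to 2\<close>
    define p where "p = transpose 2 (transpose 1 i j) \<circ> transpose 1 i"
    have t1: "transpose 1 i j \<noteq> 1" "transpose 1 i j \<in> {1..n}"
      using ij by (auto simp: transpose_def)
    have p: "p permutes {1..n}"
      unfolding p_def using t1 ij n2 by (intro permutes_compose permutes_swap_id) auto
    have "p i = 1" "p j = 2"
      using t1(1) by (auto simp: p_def transpose_def)
    define \<delta> where "\<delta> = relabel p \<gamma>"
    have \<delta>: "\<delta> \<in> brauer m n" unfolding \<delta>_def by (rule relabel_brauer[OF Suc(3) p])
    have low: "{Lower 1, Lower 2} \<in> \<delta>"
      using relabel_mem[OF ij(1), of p] \<open>p i = 1\<close> \<open>p j = 2\<close> by (simp add: \<delta>_def)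
    have "upper_hooks m \<delta> \<noteq> {}" using block_counts[OF \<delta>] \<open>n < m\<close> by auto
    then obtain C where C: "C \<in> \<delta>" "C \<subseteq> uppers m" by (auto simp: upper_hooks_def)
    obtain a b where ab: "C = {a, b}" using matching_block[OF \<delta>[unfolded brauer_eq] C(1)] by metis
    have ab': "{a, b} \<in> \<delta>" "a \<in> uppers m" "b \<in> uppers m" using C ab by auto
    note prev = brauer_mult_hook[OF \<delta> \<eta>(1-3) \<eta>(4) ab' low, OF n2 n2 n2]
    let ?\<alpha> = "(\<delta> - {{a, b}, {Lower 1, Lower 2}}) \<union> ({{a, Lower 1}} \<union> {{b, Lower 2}})"
    have "card (lower_hooks n \<delta>) = Suc k"
      using Suc(2) card_lower_hooks_relabel[OF Suc(3) p] by (simp add: \<delta>_def)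
    hence "k = card (lower_hooks n ?\<alpha>)" using prev(3) by simp
    from Suc(1)[OF this prev(1)] have "?\<alpha> \<in> T" .
    from hook[OF this n2] have "\<delta> \<in> T" using prev(2) by simp
    hence "relabel (inv p) \<delta> \<in> T" by (rule relabel_T[OF permutes_inv[OF p]])
    thus ?case
      by (simp add: \<delta>_def relabel_comp permutes_inv_o(2)[OF p] relabel_id)
  qed
qed

section \<open>Generators of minimal number\<close>

text \<open>Exchange of the two rows, followed by \<open>\<rho>\<close> on the new upper row and by \<open>\<pi>\<close> on the new lower row.
  Turning \<open>\<sigma>\<close> around in this way produces the particular generators needed.\<close>

fun turn :: "(nat \<Rightarrow> nat) \<Rightarrow> (nat \<Rightarrow> nat) \<Rightarrow> vertex \<Rightarrow> vertex" where
  "turn \<rho> \<pi> (Upper i) = Lower (\<pi> i)"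
| "turn \<rho> \<pi> (Lower i) = Upper (\<rho> i)"
| "turn \<rho> \<pi> (Middle i) = Middle i"

lemma turn_mem: "{u, v} \<in> \<sigma> \<Longrightarrow> {turn \<rho> \<pi> u, turn \<rho> \<pi> v} \<in> (`) (turn \<rho> \<pi>) ` \<sigma>"
  by (metis image_empty image_eqI image_insert)

lemma inj_turn: "inj \<rho> \<Longrightarrow> inj \<pi> \<Longrightarrow> inj (turn \<rho> \<pi>)"
  by (rule injI) (case_tac x; case_tac y; auto dest: injD)

lemma turn_full_rank:
  assumes \<sigma>: "\<sigma> \<in> brauer n m" and edges: "\<forall>j\<in>{1..n}. {Upper j, Lower (s j)} \<in> \<sigma>"
    and \<rho>: "\<rho> permutes {1..m}" and \<pi>: "\<pi> permutes {1..n}"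
  shows "(`) (turn \<rho> \<pi>) ` \<sigma> \<in> full_rank m n"
proof -
  note s = bspec[OF edges]
  have "turn \<rho> \<pi> ` uppers n = Lower ` \<pi> ` {1..n}" "turn \<rho> \<pi> ` lowers m = Upper ` \<rho> ` {1..m}"
    by (simp_all add: uppers_def lowers_def image_image)
  hence img: "turn \<rho> \<pi> ` (uppers n \<union> lowers m) = uppers m \<union> lowers n"
    using permutes_image[OF \<rho>] permutes_image[OF \<pi>] by (auto simp: image_Un uppers_def lowers_def)
  have "inj_on (turn \<rho> \<pi>) (uppers n \<union> lowers m)"
    using inj_turn[OF permutes_inj[OF \<rho>] permutes_inj[OF \<pi>]] inj_on_subset by blast
  hence br: "(`) (turn \<rho> \<pi>) ` \<sigma> \<in> brauer m n"
    using matching_image[OF \<sigma>[unfolded brauer_eq]] img unfolding brauer_eq by metis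
  have "\<not> turn \<rho> \<pi> ` B \<subseteq> lowers n" if B: "B \<in> \<sigma>" for B
  proof
    assume low: "turn \<rho> \<pi> ` B \<subseteq> lowers n"
    obtain u v where uv: "B = {u, v}" "u \<in> uppers n \<union> lowers m"
      using matching_block[OF \<sigma>[unfolded brauer_eq] B] by metis
    hence "u \<in> uppers n" using low by (auto simp: lowers_def)
    then obtain j where j: "u = Upper j" "j \<in> {1..n}" by (auto simp: uppers_def)
    have "B = {Upper j, Lower (s j)}"
      using matching_unique_block[OF \<sigma>[unfolded brauer_eq] B s[OF j(2)], of u] uv j by auto
    thus False using low by auto
  qed
  thus ?thesis using br by (auto simp: full_rank_def lower_hooks_def)
qed

lemma transversals_of_full_rank:
  assumes \<sigma>: "\<sigma> \<in> brauer n m" and rank: "brauer_rank n m \<sigma> = n"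
  shows "\<exists>s. \<forall>j\<in>{1..n}. {Upper j, Lower (s j)} \<in> \<sigma>"
proof -
  note pm = \<sigma>[unfolded brauer_eq]
  have "upper_hooks n \<sigma> = {}"
    using block_counts(1)[OF \<sigma>] rank brauer_finite[OF \<sigma>] by (simp add: upper_hooks_def)
  hence no: "\<not> B \<subseteq> uppers n" if "B \<in> \<sigma>" for B using that by (auto simp: upper_hooks_def)
  have "\<exists>k. {Upper j, Lower k} \<in> \<sigma>" if j: "j \<in> {1..n}" for j
  proof -
    obtain v where v: "{Upper j, v} \<in> \<sigma>" using matching_partner[OF pm, of "Upper j"] j by auto
    have "v \<in> lowers m" using no[OF v] matching_vertices(2)[OF pm v] j by auto
    thus ?thesis using v by (auto simp: lowers_def)
  qed
  thus ?thesis by metis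
qed

text \<open>A partial system of representatives for the fibres of \<open>h\<close> extends to a full one.\<close>

lemma bij_betw_extend:
  assumes "A0 \<subseteq> F" "inj_on h A0" "h ` F = K"
  obtains A where "A0 \<subseteq> A" "A \<subseteq> F" "bij_betw h A K"
proof -
  have "\<forall>k\<in>K. \<exists>x. x \<in> F \<and> h x = k" using assms(3) by blast
  then obtain c where c: "\<And>k. k \<in> K \<Longrightarrow> c k \<in> F" "\<And>k. k \<in> K \<Longrightarrow> h (c k) = k"
    by metis
  define X where "X = K - h ` A0"
  have hc: "h (c k) = k" if "k \<in> X" for k using c that by (simp add: X_def)
  have "h ` c ` X = X" by (simp add: image_image hc)
  moreover have "h ` A0 \<subseteq> K" using assms(1,3) by blast
  ultimately have img: "h ` (A0 \<union> c ` X) = K" by (auto simp: image_Un X_def)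
  have inj: "inj_on h (A0 \<union> c ` X)"
  proof (rule inj_onI)
    fix x y assume xy: "x \<in> A0 \<union> c ` X" "y \<in> A0 \<union> c ` X" "h x = h y"
    have *: "z \<in> A0 \<and> h z \<notin> X \<or> z = c (h z) \<and> h z \<in> X" if "z \<in> A0 \<union> c ` X" for z
      using that hc by (auto simp: X_def)
    show "x = y" using *[OF xy(1)] *[OF xy(2)] xy(3) assms(2) by (metis inj_onD)
  qed
  have "c ` X \<subseteq> F" using c(1) by (auto simp: X_def)
  thus ?thesis
    using that[of "A0 \<union> c ` X"] img inj assms(1) by (simp add: bij_betw_def)
qed

text \<open>The lower bound. An element of rank \<open>n\<close> has the least possible number \<open>(m - n) / 2\<close> of upper
  hooks, so if a product has rank \<open>n\<close> then its left factor has the same upper hooks; by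
  induction, these are the upper hooks of a generator.\<close>

lemma subsemigroup_upper_hooks:
  assumes \<sigma>: "\<sigma> \<in> brauer n m" and A: "A \<subseteq> brauer m n"
    and x: "x \<in> subsemigroup_gen (sandwich_mult m n \<sigma>) A"
  shows "x \<in> brauer m n"
    and "x \<in> full_rank m n \<Longrightarrow> \<exists>a\<in>A. upper_hooks m a = upper_hooks m x"
proof -
  have "x \<in> brauer m n \<and> (x \<in> full_rank m n \<longrightarrow> (\<exists>a\<in>A. upper_hooks m a = upper_hooks m x))"
    using x
  proof induction
    case (base a)
    thus ?case using A by auto
  next
    case (mult \<alpha> \<beta>)
    let ?p = "sandwich_mult m n \<sigma> \<alpha> \<beta>"
    note \<alpha>\<sigma> = brauer_mult_closed[OF _ \<sigma>, of \<alpha> m]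
    have p: "?p \<in> brauer m n"
      unfolding sandwich_mult_def using mult by (intro brauer_mult_closed[OF \<alpha>\<sigma>]) auto
    have "\<exists>a\<in>A. upper_hooks m a = upper_hooks m ?p" if full: "?p \<in> full_rank m n"
    proof -
      have sub: "upper_hooks m \<alpha> \<subseteq> upper_hooks m ?p"
        unfolding sandwich_mult_def
        using mult upper_hooks_mult[OF _ \<sigma>, of \<alpha> m] upper_hooks_mult[OF \<alpha>\<sigma>, of \<beta> n] by blast
      have fin: "finite (upper_hooks m ?p)" using brauer_finite[OF p] by (simp add: upper_hooks_def)
      have le: "card (upper_hooks m \<alpha>) \<le> card (upper_hooks m ?p)" using sub fin by (rule card_mono[rotated])
      have counts: "m = brauer_rank m n \<alpha> + 2 * card (upper_hooks m \<alpha>)"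
          "n = brauer_rank m n \<alpha> + 2 * card (lower_hooks n \<alpha>)"
          "m = n + 2 * card (upper_hooks m ?p)"
        using block_counts[of \<alpha> m n] full_rank_card_upper_hooks[OF full] mult by auto
      hence card_eq: "card (upper_hooks m \<alpha>) = card (upper_hooks m ?p)" using le by linarith
      hence eq: "upper_hooks m \<alpha> = upper_hooks m ?p" using sub fin by (intro card_subset_eq)
      have "card (lower_hooks n \<alpha>) = 0" using counts card_eq by linarith
      hence "\<alpha> \<in> full_rank m n"
        using mult brauer_finite[of \<alpha> m n] by (auto simp: full_rank_def lower_hooks_def)
      thus ?thesis using mult eq by auto
    qed
    thus ?case using p by blast
  qed
  thus "x \<in> brauer m n" "x \<in> full_rank m n \<Longrightarrow> \<exists>a\<in>A. upper_hooks m a = upper_hooks m x" by auto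
qed

lemma sandwich_mult_eq:
  assumes \<sigma>: "\<sigma> \<in> brauer n m" and edges: "\<forall>j\<in>{1..n}. {Upper j, Lower (s j)} \<in> \<sigma>"
    and "\<alpha> \<in> brauer m n" "\<beta> \<in> brauer m n"
  shows "sandwich_mult m n \<sigma> \<alpha> \<beta> = brauer_mult m n \<alpha> (brauer_mult n n \<sigma> \<beta>)"
  unfolding sandwich_mult_def by (rule brauer_mult_assoc_of_transversals[OF assms])

text \<open>Elements \<open>t i\<close> for \<open>i = 2..n\<close> and \<open>h\<close> of rank \<open>n\<close> with pairwise distinct kernels such that \<open>\<sigma> (t i)\<close> is
  the transposition \<open>(1 i)\<close> and \<open>\<sigma> h\<close> has the hooks \<open>{1, 2}\<close> and \<open>{1', 2'}\<close>. Fix a lower hook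
  \<open>{c', d'}\<close> of \<open>\<sigma>\<close>. All upper hooks of \<open>t i\<close> are mirrored lower hooks of \<open>\<sigma>\<close>, except that \<open>{c, s i}\<close>
  replaces \<open>{c, d}\<close>: the path from \<open>i\<close> in the product runs through \<open>s i\<close>, \<open>c\<close> and \<open>d\<close>. In \<open>h\<close> the
  exception is \<open>{s 1, s 2}\<close>.\<close>

lemma special_generators:
  assumes \<sigma>: "\<sigma> \<in> brauer n m" and edges: "\<forall>j\<in>{1..n}. {Upper j, Lower (s j)} \<in> \<sigma>"
    and "n < m"
  obtains A where "A \<subseteq> full_rank m n" "inj_on (upper_hooks m) A"
    "\<forall>i\<in>{2..n}. \<exists>a\<in>A. \<forall>j\<in>{1..n}. {Upper j, Lower (transpose 1 i j)} \<in> brauer_mult n n \<sigma> a"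
    "2 \<le> n \<longrightarrow> (\<exists>a\<in>A. {Upper 1, Upper 2} \<in> brauer_mult n n \<sigma> a \<and>
      {Lower 1, Lower 2} \<in> brauer_mult n n \<sigma> a \<and>
      (\<forall>j\<in>{3..n}. {Upper j, Lower j} \<in> brauer_mult n n \<sigma> a))"
proof -
  note s = bspec[OF edges]
  note pm = \<sigma>[unfolded brauer_eq]
  have "n = brauer_rank n m \<sigma> + 2 * card (upper_hooks n \<sigma>)"
    "m = brauer_rank n m \<sigma> + 2 * card (lower_hooks m \<sigma>)"
    using block_counts[OF \<sigma>] by auto
  hence "lower_hooks m \<sigma> \<noteq> {}" using \<open>n < m\<close> by auto
  then obtain B where B: "B \<in> \<sigma>" "B \<subseteq> lowers m" by (auto simp: lower_hooks_def)
  obtain u v where uv: "B = {u, v}" "u \<noteq> v" using matching_block[OF pm B(1)] by metis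
  then obtain c d where "u = Lower c" "v = Lower d" "c \<in> {1..m}" "d \<in> {1..m}"
    using B unfolding lowers_def by blast
  with uv B have cd: "{Lower c, Lower d} \<in> \<sigma>" "c \<noteq> d" "c \<in> {1..m}" "d \<in> {1..m}" by auto
  have sm: "s j \<in> {1..m}" if "j \<in> {1..n}" for j
    using matching_vertices(2)[OF pm s[OF that]] by simp
  have s_inj: "i = j" if "i \<in> {1..n}" "j \<in> {1..n}" "s i = s j" for i j
    using matching_unique[OF pm, of "Lower (s i)" "Upper i" "Upper j"] s[OF that(1)] s[OF that(2)] that(3)
    by (simp add: insert_commute)
  have s_cd: "s j \<noteq> c" "s j \<noteq> d" if "j \<in> {1..n}" for j
    using matching_unique_block[OF pm s[OF that] cd(1), of "Lower (s j)"] by (auto simp: doubleton_eq_iff)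
  \<comment> \<open>the factor \<open>transpose 1 i\<close> is the permutation to be realised; the upper one turns \<open>{c, d}\<close> into \<open>{c, s i}\<close>\<close>
  define t where "t i = (`) (turn (transpose d (s i)) (transpose 1 i)) ` \<sigma>" for i
  define h where "h = (`) (turn (transpose c (s 1) \<circ> transpose d (s 2)) id) ` \<sigma>"
  have t_full: "t i \<in> full_rank m n" if "i \<in> {2..n}" for i
    unfolding t_def using that cd sm[of i]
    by (intro turn_full_rank[OF \<sigma> edges] permutes_swap_id) auto
  have h_full: "h \<in> full_rank m n" if "2 \<le> n"
    unfolding h_def using that cd sm[of 1] sm[of 2]
    by (intro turn_full_rank[OF \<sigma> edges] permutes_compose permutes_swap_id permutes_id) auto
  have edge: "(Upper j, Middle (s j)) \<in> (product_graph \<sigma> a)\<^sup>*" if "j \<in> {1..n}" for j a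
    using product_graph_left[OF s[OF that], of a] by simp
  have edge_cd: "(Middle c, Middle d) \<in> (product_graph \<sigma> a)\<^sup>*" for a
    using product_graph_left[OF cd(1), of a] by simp
  have t_hook: "{Upper c, Upper (s i)} \<in> t i" if "i \<in> {2..n}" for i
    using turn_mem[OF cd(1), of "transpose d (s i)" "transpose 1 i"] cd(2) s_cd(1)[of i] that
    by (auto simp: t_def transpose_def)
  have t_end: "{Upper d, Lower 1} \<in> t i" if "i \<in> {2..n}" for i
    using turn_mem[OF s[of i], of "transpose d (s i)" "transpose 1 i"] that
    by (auto simp: t_def insert_commute)
  have t_rest: "{Upper (s j), Lower (transpose 1 i j)} \<in> t i"
    if "i \<in> {2..n}" "j \<in> {1..n}" "j \<noteq> i" for i j
  proof -
    have "s j \<noteq> s i" using that s_inj[of j i] by auto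
    thus ?thesis
      using turn_mem[OF s[OF that(2)], of "transpose d (s i)" "transpose 1 i"] s_cd(2)[OF that(2)]
      by (auto simp: t_def insert_commute transpose_def)
  qed
  have t_prod: "{Upper j, Lower (transpose 1 i j)} \<in> brauer_mult n n \<sigma> (t i)"
    if i: "i \<in> {2..n}" and j: "j \<in> {1..n}" for i j
  proof (rule brauer_multI[OF \<sigma>, of "t i" n])
    show "t i \<in> brauer m n" using t_full[OF i] by (simp add: full_rank_def)
    show "Upper j \<in> uppers n \<union> lowers n" using j by simp
    show "Lower (transpose 1 i j) \<in> uppers n \<union> lowers n" using i j by (auto simp: transpose_def)
    let ?G = "product_graph \<sigma> (t i)"
    have "(Middle (s j), Lower (transpose 1 i j)) \<in> ?G\<^sup>*"
    proof (cases "j = i")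
      case True
      have "(Middle c, Middle (s i)) \<in> ?G\<^sup>*" "(Middle d, Lower 1) \<in> ?G\<^sup>*"
        using product_graph_right[OF t_hook[OF i], of \<sigma>] product_graph_right[OF t_end[OF i], of \<sigma>] by simp_all
      thus ?thesis using edge_cd[of "t i"] True by (simp, meson product_graph_symD rtrancl_trans)
    next
      case False
      thus ?thesis using product_graph_right[OF t_rest[OF i j False], of \<sigma>] by simp
    qed
    thus "(Upper j, Lower (transpose 1 i j)) \<in> ?G\<^sup>*" using edge[OF j] by (meson rtrancl_trans)
  qed simp
  have h_mem: "{Upper (s 1), Upper (s 2)} \<in> h" "{Upper c, Lower 1} \<in> h" "{Upper d, Lower 2} \<in> h"
    "\<And>j. j \<in> {3..n} \<Longrightarrow> {Upper (s j), Lower j} \<in> h" if n2: "2 \<le> n"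
  proof -
    have ne: "s 1 \<noteq> c" "s 1 \<noteq> d" "s 2 \<noteq> c" "s 2 \<noteq> d" "s 1 \<noteq> s 2"
      using s_cd[of 1] s_cd[of 2] s_inj[of 1 2] n2 by auto
    let ?turn = "turn (transpose c (s 1) \<circ> transpose d (s 2)) id"
    have turn: "{?turn u, ?turn v} \<in> h" if "{u, v} \<in> \<sigma>" for u v
      unfolding h_def using that by (rule turn_mem)
    show "{Upper (s 1), Upper (s 2)} \<in> h"
      using turn[OF cd(1)] ne cd(2) by (simp add: transpose_def)
    show "{Upper c, Lower 1} \<in> h" "{Upper d, Lower 2} \<in> h"
      using turn[OF s[of 1]] turn[OF s[of 2]] ne n2 cd(2) by (auto simp: transpose_def insert_commute)
    show "{Upper (s j), Lower j} \<in> h" if j: "j \<in> {3..n}" for j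
    proof -
      have "s j \<noteq> c" "s j \<noteq> d" "s j \<noteq> s 1" "s j \<noteq> s 2"
        using s_cd[of j] s_inj[of j 1] s_inj[of j 2] j by auto
      thus ?thesis using turn[OF s[of j]] j by (auto simp: transpose_def insert_commute)
    qed
  qed
  have h_prod: "{Upper 1, Upper 2} \<in> brauer_mult n n \<sigma> h \<and> {Lower 1, Lower 2} \<in> brauer_mult n n \<sigma> h \<and>
      (\<forall>j\<in>{3..n}. {Upper j, Lower j} \<in> brauer_mult n n \<sigma> h)" if n2: "2 \<le> n"
  proof -
    let ?G = "product_graph \<sigma> h"
    have h: "h \<in> brauer m n" using h_full[OF n2] by (simp add: full_rank_def)
    have "(Middle (s 1), Middle (s 2)) \<in> ?G\<^sup>*"
      using product_graph_right[OF h_mem(1)[OF n2], of \<sigma>] by simp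
    hence "(Upper 1, Upper 2) \<in> ?G\<^sup>*"
      using edge[of 1 h] edge[of 2 h] n2 by (simp, meson product_graph_symD rtrancl_trans)
    hence 1: "{Upper 1, Upper 2} \<in> brauer_mult n n \<sigma> h"
      using n2 by (intro brauer_multI[OF \<sigma> h]) auto
    have "(Middle c, Lower 1) \<in> ?G\<^sup>*" "(Middle d, Lower 2) \<in> ?G\<^sup>*"
      using product_graph_right[OF h_mem(2)[OF n2], of \<sigma>] product_graph_right[OF h_mem(3)[OF n2], of \<sigma>]
      by simp_all
    hence "(Lower 1, Lower 2) \<in> ?G\<^sup>*"
      using edge_cd[of h] by (meson product_graph_symD rtrancl_trans)
    hence 2: "{Lower 1, Lower 2} \<in> brauer_mult n n \<sigma> h"
      using n2 by (intro brauer_multI[OF \<sigma> h]) auto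
    have 3: "{Upper j, Lower j} \<in> brauer_mult n n \<sigma> h" if j: "j \<in> {3..n}" for j
    proof -
      have "(Middle (s j), Lower j) \<in> ?G\<^sup>*"
        using product_graph_right[OF h_mem(4)[OF n2 j], of \<sigma>] by simp
      hence "(Upper j, Lower j) \<in> ?G\<^sup>*" using edge[of j h] j by (meson atLeastAtMost_iff le_trans one_le_numeral rtrancl_trans)
      thus ?thesis using j by (intro brauer_multI[OF \<sigma> h]) auto
    qed
    show ?thesis using 1 2 3 by blast
  qed
  have t_inj: "i = k" if ik: "i \<in> {2..n}" "k \<in> {2..n}" "upper_hooks m (t i) = upper_hooks m (t k)" for i k
  proof -
    have "{Upper c, Upper (s i)} \<in> upper_hooks m (t i)"
      using t_hook[OF ik(1)] cd sm[of i] ik(1) by (auto simp: upper_hooks_def)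
    hence "{Upper c, Upper (s i)} \<in> t k" using ik(3) by (auto simp: upper_hooks_def)
    hence "Upper (s i) = Upper (s k)"
      using matching_unique[of "t k" _ "Upper c"] t_hook[OF ik(2)] t_full[OF ik(2)]
      unfolding full_rank_def brauer_eq by blast
    thus ?thesis using s_inj[of i k] ik by auto
  qed
  have th: "upper_hooks m (t i) \<noteq> upper_hooks m h" if i: "i \<in> {2..n}" for i
  proof
    assume eq: "upper_hooks m (t i) = upper_hooks m h"
    have n2: "2 \<le> n" using i by simp
    have "{Upper c, Upper (s i)} \<in> upper_hooks m (t i)"
      using t_hook[OF i] cd sm[of i] i by (auto simp: upper_hooks_def)
    hence "{Upper c, Upper (s i)} \<in> h" using eq by (auto simp: upper_hooks_def)
    hence "Upper (s i) = Lower 1"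
      using matching_unique[of h _ "Upper c"] h_mem(2)[OF n2] h_full[OF n2]
      unfolding full_rank_def brauer_eq by blast
    thus False by simp
  qed
  let ?A = "t ` {2..n} \<union> (if 2 \<le> n then {h} else {})"
  show ?thesis
  proof (rule that[of ?A])
    show "?A \<subseteq> full_rank m n" using t_full h_full by auto
    show "inj_on (upper_hooks m) ?A"
    proof (rule inj_onI)
      fix x y assume xy: "x \<in> ?A" "y \<in> ?A" "upper_hooks m x = upper_hooks m y"
      have mem: "z = h \<or> (\<exists>i\<in>{2..n}. z = t i)" if "z \<in> ?A" for z
        using that by (auto split: if_splits)
      show "x = y" using mem[OF xy(1)] mem[OF xy(2)] xy(3) t_inj th by metis
    qed
    show "\<forall>i\<in>{2..n}. \<exists>a\<in>?A. \<forall>j\<in>{1..n}. {Upper j, Lower (transpose 1 i j)} \<in> brauer_mult n n \<sigma> a"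
      using t_prod by blast
    show "2 \<le> n \<longrightarrow> (\<exists>a\<in>?A. {Upper 1, Upper 2} \<in> brauer_mult n n \<sigma> a \<and>
      {Lower 1, Lower 2} \<in> brauer_mult n n \<sigma> a \<and>
      (\<forall>j\<in>{3..n}. {Upper j, Lower j} \<in> brauer_mult n n \<sigma> a))"
      using h_prod by auto
  qed
qed

theorem theorem6p9:
  fixes m n r :: nat and \<sigma> :: "vertex set set"
  assumes "m mod 2 = n mod 2"
    and "\<sigma> \<in> brauer n m"
    and "r = brauer_rank n m \<sigma>"
    and "r = n" and "n < m"
  shows "semigroup_rank (brauer m n) (sandwich_mult m n \<sigma>) =
         (m choose n) * double_fact (m - n - 1)"
proof -
  let ?f = "sandwich_mult m n \<sigma>"
  note \<sigma> = assms(2)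
  have "brauer_rank n m \<sigma> = n" using assms by simp
  from transversals_of_full_rank[OF \<sigma> this]
  obtain s where edges: "\<forall>j\<in>{1..n}. {Upper j, Lower (s j)} \<in> \<sigma>" ..
  have "even (m - n)" using assms(1,5) by presburger
  with card_kernels[of n m] \<open>n < m\<close> have K: "finite (kernels m n)"
    "card (kernels m n) = (m choose n) * double_fact (m - n - 1)" by auto
  have img: "upper_hooks m ` full_rank m n = kernels m n"
    using upper_hooks_full_rank \<open>n < m\<close> by simp
  \<comment> \<open>distinct kernels require distinct generators\<close>
  have lower_bound: "card (kernels m n) \<le> card A"
    if A: "A \<subseteq> brauer m n" "finite A" "subsemigroup_gen ?f A = brauer m n" for A
  proof -
    have "kernels m n \<subseteq> upper_hooks m ` A"
    proof
      fix k assume "k \<in> kernels m n"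
      then obtain x where x: "x \<in> full_rank m n" "k = upper_hooks m x" using img by blast
      have "x \<in> subsemigroup_gen ?f A" using x A(3) by (simp add: full_rank_def)
      from subsemigroup_upper_hooks(2)[OF \<sigma> A(1) this x(1)] show "k \<in> upper_hooks m ` A" using x(2) by (auto simp: image_iff)
    qed
    thus ?thesis by (rule surj_card_le[OF A(2)])
  qed
  from special_generators[OF \<sigma> edges \<open>n < m\<close>] obtain A0 where A0: "A0 \<subseteq> full_rank m n" "inj_on (upper_hooks m) A0"
    and star: "\<forall>i\<in>{2..n}. \<exists>a\<in>A0. \<forall>j\<in>{1..n}. {Upper j, Lower (transpose 1 i j)} \<in> brauer_mult n n \<sigma> a"
    and hook: "2 \<le> n \<longrightarrow> (\<exists>a\<in>A0. {Upper 1, Upper 2} \<in> brauer_mult n n \<sigma> a \<and>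
      {Lower 1, Lower 2} \<in> brauer_mult n n \<sigma> a \<and>
      (\<forall>j\<in>{3..n}. {Upper j, Lower j} \<in> brauer_mult n n \<sigma> a))" .
  from bij_betw_extend[OF A0 img] obtain A where A: "A0 \<subseteq> A" "A \<subseteq> full_rank m n"
    "bij_betw (upper_hooks m) A (kernels m n)" .
  have A_br: "A \<subseteq> brauer m n" using A(2) by (auto simp: full_rank_def)
  have cardA: "card A = card (kernels m n)" using bij_betw_same_card[OF A(3)] .
  have finA: "finite A" using bij_betw_finite[OF A(3)] K(1) by simp
  let ?T = "subsemigroup_gen ?f A"
  have T: "?T \<subseteq> brauer m n" using subsemigroup_upper_hooks(1)[OF \<sigma> A_br] by blast
  have mult: "brauer_mult m n \<alpha> (brauer_mult n n \<sigma> a) \<in> ?T" if "\<alpha> \<in> ?T" "a \<in> A" for \<alpha> a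
  proof -
    have "\<alpha> \<in> brauer m n" "a \<in> brauer m n" using that T A_br by blast+
    hence "?f \<alpha> a = brauer_mult m n \<alpha> (brauer_mult n n \<sigma> a)" by (rule sandwich_mult_eq[OF \<sigma> edges])
    thus ?thesis
      using subsemigroup_gen.mult[OF that(1) subsemigroup_gen.base[of a A ?f, OF that(2)]] by simp
  qed
  have gen: "?T = brauer m n"
  proof -
    \<comment> \<open>for \<open>n < 2\<close> there are no lower hooks, and \<open>a\<close> is arbitrary\<close>
    obtain a where a: "2 \<le> n \<Longrightarrow> a \<in> A" and h: "2 \<le> n \<Longrightarrow> {Upper 1, Upper 2} \<in> brauer_mult n n \<sigma> a \<and>
      {Lower 1, Lower 2} \<in> brauer_mult n n \<sigma> a \<and>
      (\<forall>j\<in>{3..n}. {Upper j, Lower j} \<in> brauer_mult n n \<sigma> a)"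
      using hook A(1) by blast
    show ?thesis
    proof (rule generated_eq_brauer[OF \<open>n < m\<close> T, of "brauer_mult n n \<sigma> a"])
      fix \<alpha> i assume \<alpha>: "\<alpha> \<in> ?T" and i: "i \<in> {2..n}"
      obtain b where b: "b \<in> A" "\<forall>j\<in>{1..n}. {Upper j, Lower (transpose 1 i j)} \<in> brauer_mult n n \<sigma> b"
        using star i A(1) by blast
      have "b \<in> brauer m n" using b(1) A_br by blast
      have "brauer_mult m n \<alpha> (brauer_mult n n \<sigma> b) = relabel (transpose 1 i) \<alpha>"
        using \<alpha> T b(2) i
        by (intro brauer_mult_permutation brauer_mult_closed[OF \<sigma> \<open>b \<in> brauer m n\<close>] permutes_swap_id) auto
      thus "relabel (transpose 1 i) \<alpha> \<in> ?T" using mult[OF \<alpha> b(1)] by simp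
    next
      show "brauer_mult n n \<sigma> a \<in> brauer n n" if "2 \<le> n"
        using a[OF that] A_br by (intro brauer_mult_closed[OF \<sigma>]) auto
      show "{Upper 1, Upper 2} \<in> brauer_mult n n \<sigma> a" "{Lower 1, Lower 2} \<in> brauer_mult n n \<sigma> a" if "2 \<le> n"
        using h[OF that] by auto
      show "{Upper j, Lower j} \<in> brauer_mult n n \<sigma> a" if "j \<in> {3..n}" for j
        using h that by auto
      show "brauer_mult m n \<alpha> (brauer_mult n n \<sigma> a) \<in> ?T" if "\<alpha> \<in> ?T" "2 \<le> n" for \<alpha>
        using mult that a by blast
      have "A \<subseteq> ?T \<inter> full_rank m n" using A(2) by (auto intro: subsemigroup_gen.base)
      thus "kernels m n \<subseteq> upper_hooks m ` (?T \<inter> full_rank m n)"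
        using bij_betw_imp_surj_on[OF A(3)] by blast
    qed
  qed
  have "semigroup_rank (brauer m n) ?f = card (kernels m n)"
    unfolding semigroup_rank_def
    using A_br finA cardA gen lower_bound by (intro Least_equality) blast+
  thus ?thesis using K(2) by simp
qed

end
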